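(* Let $\mathcal{C}$ be an arbitrary small additive category, let $\mathcal{A}$ be a set of objects of $\mathbf{Mod}\,\mathcal{C}$, and let $\sigma = \sigma_{\mathcal{A}}$ be the purity projectively generated by $\mathcal{A}$. For every cardinal $\lambda$ there is a cardinal $\kappa$ such that for every module $M \in \mathbf{Mod}\,\mathcal{C}$ and every submodule $L \subseteq M$ with $|M| \geq \kappa$ and $|M/L| \leq \lambda$, the submodule $L$ contains a non-trivial (i.e. non-zero) submodule which is $\sigma$-pure in $M$.
   Context: For a small additive category $\mathcal{C}$, $\mathbf{Mod}\,\mathcal{C}$ denotes the category of $\mathcal{C}$-modules, i.e. additive functors $\mathcal{C}^{\mathrm{op}} \to \mathbf{Ab}$ to abelian groups. Let $\mathcal{S}$ be a skeleton of $\mathcal{C}$, i.e. a set of representatives of the isomorphism classes of objects of $\mathcal{C}$. The cardinality of a module $X \in \mathbf{Mod}\,\mathcal{C}$ is $|X| := \sum_{C \in \mathcal{S}} |X(C)|$. For a class $\mathcal{A}$ of modules in $\mathbf{Mod}\,\mathcal{C}$, the purity projectively generated by $\mathcal{A}$, denoted $\sigma_{\mathcal{A}}$, is the class of all short exact sequences $\eta$ in $\mathbf{Mod}\,\mathcal{C}$ such that the induced sequence $\mathrm{Hom}_{\mathbf{Mod}\,\mathcal{C}}(A,\eta)$ is exact in $\mathbf{Ab}$ for all $A \in \mathcal{A}$. A submodule $L$ of a module $M$ is called $\sigma_{\mathcal{A}}$-pure (in $M$) if the short exact sequence $0 \to L \to M \to M/L \to 0$ is taken to a (short) exact sequence in $\mathbf{Ab}$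 by $\mathrm{Hom}_{\mathbf{Mod}\,\mathcal{C}}(A,-)$ for every $A \in \mathcal{A}$. *)

theory Defs
  imports "HOL-Algebra.Elementary_Groups"
begin

unbundle cardinal_syntax

text \<open>
  Abelian groups are the commutative groups of HOL-Algebra; they are written multiplicatively
  throughout, so the zero element is \<open>\<one>\<close> and the sum is \<open>\<otimes>\<close>.
\<close>

section \<open>Small additive categories\<close>

text \<open>
  Hom-sets are indexed by source and target and need not be disjoint; hence identities and
  composition carry the objects as arguments, \<open>Comp \<C> a b c g f\<close> being \<open>g \<circ> f\<close> for
  \<open>f : a \<rightarrow> b\<close> and \<open>g : b \<rightarrow> c\<close>.
\<close>

record ('o, 'm) additive_cat =
  Obj :: "'o set"
  Hom :: "'o \<Rightarrow> 'o \<Rightarrow> 'm monoid"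
  Idt :: "'o \<Rightarrow> 'm"
  Comp :: "'o \<Rightarrow> 'o \<Rightarrow> 'o \<Rightarrow> 'm \<Rightarrow> 'm \<Rightarrow> 'm"

abbreviation Mor :: "('o, 'm) additive_cat \<Rightarrow> 'o \<Rightarrow> 'o \<Rightarrow> 'm set" where
  "Mor \<C> a b \<equiv> carrier (Hom \<C> a b)"

definition category :: "('o, 'm) additive_cat \<Rightarrow> bool" where
  "category \<C> \<longleftrightarrow>
     (\<forall>a\<in>Obj \<C>. Idt \<C> a \<in> Mor \<C> a a) \<and>
     (\<forall>a\<in>Obj \<C>. \<forall>b\<in>Obj \<C>. \<forall>c\<in>Obj \<C>. \<forall>f\<in>Mor \<C> a b. \<forall>g\<in>Mor \<C> b c.
        Comp \<C> a b c g f \<in> Mor \<C> a c) \<and>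
     (\<forall>a\<in>Obj \<C>. \<forall>b\<in>Obj \<C>. \<forall>f\<in>Mor \<C> a b.
        Comp \<C> a a b f (Idt \<C> a) = f \<and> Comp \<C> a b b (Idt \<C> b) f = f) \<and>
     (\<forall>a\<in>Obj \<C>. \<forall>b\<in>Obj \<C>. \<forall>c\<in>Obj \<C>. \<forall>d\<in>Obj \<C>.
        \<forall>f\<in>Mor \<C> a b. \<forall>g\<in>Mor \<C> b c. \<forall>h\<in>Mor \<C> c d.
        Comp \<C> a b d (Comp \<C> b c d h g) f = Comp \<C> a c d h (Comp \<C> a b c g f))"

definition preadditive_category :: "('o, 'm) additive_cat \<Rightarrow> bool" where
  "preadditive_category \<C> \<longleftrightarrow>
     category \<C> \<and>
     (\<forall>a\<in>Obj \<C>. \<forall>b\<in>Obj \<C>. comm_group (Hom \<C> a b)) \<and>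
     (\<forall>a\<in>Obj \<C>. \<forall>b\<in>Obj \<C>. \<forall>c\<in>Obj \<C>.
        \<forall>f\<in>Mor \<C> a b. \<forall>f'\<in>Mor \<C> a b. \<forall>g\<in>Mor \<C> b c.
        Comp \<C> a b c g (f \<otimes>\<^bsub>Hom \<C> a b\<^esub> f') =
        Comp \<C> a b c g f \<otimes>\<^bsub>Hom \<C> a c\<^esub> Comp \<C> a b c g f') \<and>
     (\<forall>a\<in>Obj \<C>. \<forall>b\<in>Obj \<C>. \<forall>c\<in>Obj \<C>.
        \<forall>f\<in>Mor \<C> a b. \<forall>g\<in>Mor \<C> b c. \<forall>g'\<in>Mor \<C> b c.
        Comp \<C> a b c (g \<otimes>\<^bsub>Hom \<C> b c\<^esub> g') f =
        Comp \<C> a b c g f \<otimes>\<^bsub>Hom \<C> a c\<^esub> Comp \<C> a b c g' f)"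

definition zero_object :: "('o, 'm) additive_cat \<Rightarrow> 'o \<Rightarrow> bool" where
  "zero_object \<C> z \<longleftrightarrow>
     z \<in> Obj \<C> \<and>
     (\<forall>a\<in>Obj \<C>. (\<exists>!f. f \<in> Mor \<C> a z) \<and> (\<exists>!f. f \<in> Mor \<C> z a))"

definition biproduct ::
  "('o, 'm) additive_cat \<Rightarrow> 'o \<Rightarrow> 'o \<Rightarrow> 'o \<Rightarrow> 'm \<Rightarrow> 'm \<Rightarrow> 'm \<Rightarrow> 'm \<Rightarrow> bool" where
  "biproduct \<C> a b s i j p q \<longleftrightarrow>
     s \<in> Obj \<C> \<and>
     i \<in> Mor \<C> a s \<and> j \<in> Mor \<C> b s \<and> p \<in> Mor \<C> s a \<and> q \<in> Mor \<C> s b \<and>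
     Comp \<C> a s a p i = Idt \<C> a \<and>
     Comp \<C> b s b q j = Idt \<C> b \<and>
     Comp \<C> s a s i p \<otimes>\<^bsub>Hom \<C> s s\<^esub> Comp \<C> s b s j q = Idt \<C> s"

definition additive_category :: "('o, 'm) additive_cat \<Rightarrow> bool" where
  "additive_category \<C> \<longleftrightarrow>
     preadditive_category \<C> \<and>
     (\<exists>z. zero_object \<C> z) \<and>
     (\<forall>a\<in>Obj \<C>. \<forall>b\<in>Obj \<C>. \<exists>s i j p q. biproduct \<C> a b s i j p q)"

definition iso_objects :: "('o, 'm) additive_cat \<Rightarrow> 'o \<Rightarrow> 'o \<Rightarrow> bool" where
  "iso_objects \<C> a b \<longleftrightarrow>
     (\<exists>f\<in>Mor \<C> a b. \<exists>g\<in>Mor \<C> b a.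
        Comp \<C> a b a g f = Idt \<C> a \<and> Comp \<C> b a b f g = Idt \<C> b)"

definition skeleton :: "('o, 'm) additive_cat \<Rightarrow> 'o set \<Rightarrow> bool" where
  "skeleton \<C> S \<longleftrightarrow> S \<subseteq> Obj \<C> \<and> (\<forall>a\<in>Obj \<C>. \<exists>!s. s \<in> S \<and> iso_objects \<C> a s)"

section \<open>Modules over a small additive category\<close>

text \<open>
  For \<open>f : a \<rightarrow> b\<close> in \<open>\<C>\<close>, \<open>act X a b f\<close> is the induced map \<open>X(b) \<rightarrow> X(a)\<close>.
\<close>

record ('o, 'm, 'u) cmodule =
  grp :: "'o \<Rightarrow> 'u monoid"
  act :: "'o \<Rightarrow> 'o \<Rightarrow> 'm \<Rightarrow> 'u \<Rightarrow> 'u"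

definition is_module :: "('o, 'm) additive_cat \<Rightarrow> ('o, 'm, 'u) cmodule \<Rightarrow> bool" where
  "is_module \<C> X \<longleftrightarrow>
     (\<forall>a\<in>Obj \<C>. comm_group (grp X a)) \<and>
     (\<forall>a\<in>Obj \<C>. \<forall>b\<in>Obj \<C>. \<forall>f\<in>Mor \<C> a b. act X a b f \<in> hom (grp X b) (grp X a)) \<and>
     (\<forall>a\<in>Obj \<C>. \<forall>x\<in>carrier (grp X a). act X a a (Idt \<C> a) x = x) \<and>
     (\<forall>a\<in>Obj \<C>. \<forall>b\<in>Obj \<C>. \<forall>c\<in>Obj \<C>. \<forall>f\<in>Mor \<C> a b. \<forall>g\<in>Mor \<C> b c.
        \<forall>x\<in>carrier (grp X c). act X a c (Comp \<C> a b c g f) x = act X a b f (act X b c g x)) \<and>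
     (\<forall>a\<in>Obj \<C>. \<forall>b\<in>Obj \<C>. \<forall>f\<in>Mor \<C> a b. \<forall>g\<in>Mor \<C> a b. \<forall>x\<in>carrier (grp X b).
        act X a b (f \<otimes>\<^bsub>Hom \<C> a b\<^esub> g) x = act X a b f x \<otimes>\<^bsub>grp X a\<^esub> act X a b g x)"

text \<open>\<open>|X|\<close>, the cardinal sum of the \<open>|X(a)|\<close> over the skeleton \<open>S\<close>.\<close>

definition module_card :: "'o set \<Rightarrow> ('o, 'm, 'u) cmodule \<Rightarrow> ('o \<times> 'u) rel" where
  "module_card S X = |SIGMA a:S. carrier (grp X a)|"

text \<open>
  Natural transformations. They are made \<open>undefined\<close> off \<open>Obj \<C>\<close> and off the carriers, so that
  equality of functions is equality of module homomorphisms.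
\<close>

definition module_hom ::
  "('o, 'm) additive_cat \<Rightarrow> ('o, 'm, 'u) cmodule \<Rightarrow> ('o, 'm, 'v) cmodule \<Rightarrow> ('o \<Rightarrow> 'u \<Rightarrow> 'v) set" where
  "module_hom \<C> X Y =
     {\<phi> \<in> (\<Pi>\<^sub>E a\<in>Obj \<C>. hom (grp X a) (grp Y a) \<inter> extensional (carrier (grp X a))).
        \<forall>a\<in>Obj \<C>. \<forall>b\<in>Obj \<C>. \<forall>f\<in>Mor \<C> a b. \<forall>x\<in>carrier (grp X b).
          \<phi> a (act X a b f x) = act Y a b f (\<phi> b x)}"

definition hom_group ::
  "('o, 'm) additive_cat \<Rightarrow> ('o, 'm, 'u) cmodule \<Rightarrow> ('o, 'm, 'v) cmodule \<Rightarrow> ('o \<Rightarrow> 'u \<Rightarrow> 'v) monoid" where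
  "hom_group \<C> X Y =
     \<lparr>carrier = module_hom \<C> X Y,
      monoid.mult = (\<lambda>\<phi> \<psi>. \<lambda>a\<in>Obj \<C>. \<lambda>x\<in>carrier (grp X a). \<phi> a x \<otimes>\<^bsub>grp Y a\<^esub> \<psi> a x),
      one = (\<lambda>a\<in>Obj \<C>. \<lambda>x\<in>carrier (grp X a). \<one>\<^bsub>grp Y a\<^esub>)\<rparr>"

text \<open>The map \<open>Hom(A, \<phi>) : Hom(A, X) \<rightarrow> Hom(A, Y)\<close> induced by \<open>\<phi> : X \<rightarrow> Y\<close>.\<close>

definition hom_map ::
  "('o, 'm) additive_cat \<Rightarrow> ('o, 'm, 'a) cmodule \<Rightarrow> ('o \<Rightarrow> 'u \<Rightarrow> 'v)
     \<Rightarrow> ('o \<Rightarrow> 'a \<Rightarrow> 'u) \<Rightarrow> ('o \<Rightarrow> 'a \<Rightarrow> 'v)" where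
  "hom_map \<C> A \<phi> = (\<lambda>\<alpha>. \<lambda>a\<in>Obj \<C>. compose (carrier (grp A a)) (\<phi> a) (\<alpha> a))"

section \<open>Purity projectively generated by a set of modules\<close>

text \<open>
  Exactness of \<open>0 \<rightarrow> G \<rightarrow> H \<rightarrow> K \<rightarrow> 0\<close> in abelian groups. The library's \<open>short_exact_sequence\<close>
  requires all groups to have the same element type.
\<close>

definition ab_short_exact ::
  "'u monoid \<Rightarrow> ('u \<Rightarrow> 'v) \<Rightarrow> 'v monoid \<Rightarrow> ('v \<Rightarrow> 'w) \<Rightarrow> 'w monoid \<Rightarrow> bool" where
  "ab_short_exact G f H g K \<longleftrightarrow>
     comm_group G \<and> comm_group H \<and> comm_group K \<and>
     f \<in> mon G H \<and> g \<in> epi H K \<and> f ` carrier G = kernel H K g"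

text \<open>Exactness in the functor category is exactness at each object.\<close>

definition mod_short_exact ::
  "('o, 'm) additive_cat \<Rightarrow> ('o, 'm, 'u) cmodule \<Rightarrow> ('o \<Rightarrow> 'u \<Rightarrow> 'v) \<Rightarrow> ('o, 'm, 'v) cmodule
     \<Rightarrow> ('o \<Rightarrow> 'v \<Rightarrow> 'w) \<Rightarrow> ('o, 'm, 'w) cmodule \<Rightarrow> bool" where
  "mod_short_exact \<C> X \<phi> Y \<psi> Z \<longleftrightarrow>
     is_module \<C> X \<and> is_module \<C> Y \<and> is_module \<C> Z \<and>
     \<phi> \<in> module_hom \<C> X Y \<and> \<psi> \<in> module_hom \<C> Y Z \<and>
     (\<forall>a\<in>Obj \<C>. ab_short_exact (grp X a) (\<phi> a) (grp Y a) (\<psi> a) (grp Z a))"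

definition purity ::
  "('o, 'm) additive_cat \<Rightarrow> ('o, 'm, 'a) cmodule set
     \<Rightarrow> (('o, 'm, 'u) cmodule \<times> ('o \<Rightarrow> 'u \<Rightarrow> 'v) \<times> ('o, 'm, 'v) cmodule
          \<times> ('o \<Rightarrow> 'v \<Rightarrow> 'w) \<times> ('o, 'm, 'w) cmodule) set" where
  "purity \<C> \<A> =
     {(X, \<phi>, Y, \<psi>, Z). mod_short_exact \<C> X \<phi> Y \<psi> Z \<and>
        (\<forall>A\<in>\<A>. ab_short_exact (hom_group \<C> A X) (hom_map \<C> A \<phi>) (hom_group \<C> A Y)
                  (hom_map \<C> A \<psi>) (hom_group \<C> A Z))}"

section \<open>Submodules and quotients\<close>

definition submodule ::
  "('o, 'm) additive_cat \<Rightarrow> ('o \<Rightarrow> 'u set) \<Rightarrow> ('o, 'm, 'u) cmodule \<Rightarrow> bool" where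
  "submodule \<C> L M \<longleftrightarrow>
     (\<forall>a\<in>Obj \<C>. subgroup (L a) (grp M a)) \<and>
     (\<forall>a\<in>Obj \<C>. \<forall>b\<in>Obj \<C>. \<forall>f\<in>Mor \<C> a b. act M a b f ` L b \<subseteq> L a)"

definition sub_module :: "('o \<Rightarrow> 'u set) \<Rightarrow> ('o, 'm, 'u) cmodule \<Rightarrow> ('o, 'm, 'u) cmodule" where
  "sub_module L M = M\<lparr>grp := (\<lambda>a. (grp M a)\<lparr>carrier := L a\<rparr>)\<rparr>"

text \<open>
  For a coset \<open>X = L(b) + x\<close> and \<open>f : a \<rightarrow> b\<close> the set \<open>L(a) + f(X)\<close> below is the coset
  \<open>L(a) + f(x)\<close>.
\<close>

definition quotient_module ::
  "('o, 'm, 'u) cmodule \<Rightarrow> ('o \<Rightarrow> 'u set) \<Rightarrow> ('o, 'm, 'u set) cmodule" where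
  "quotient_module M L =
     \<lparr>grp = (\<lambda>a. grp M a Mod L a),
      act = (\<lambda>a b f X. L a <#>\<^bsub>grp M a\<^esub> (act M a b f ` X))\<rparr>"

definition inclusion :: "('o, 'm) additive_cat \<Rightarrow> ('o \<Rightarrow> 'u set) \<Rightarrow> 'o \<Rightarrow> 'u \<Rightarrow> 'u" where
  "inclusion \<C> L = (\<lambda>a\<in>Obj \<C>. \<lambda>x\<in>L a. x)"

definition projection ::
  "('o, 'm) additive_cat \<Rightarrow> ('o, 'm, 'u) cmodule \<Rightarrow> ('o \<Rightarrow> 'u set) \<Rightarrow> 'o \<Rightarrow> 'u \<Rightarrow> 'u set" where
  "projection \<C> M L = (\<lambda>a\<in>Obj \<C>. \<lambda>x\<in>carrier (grp M a). L a #>\<^bsub>grp M a\<^esub> x)"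

definition pure_submodule ::
  "('o, 'm) additive_cat \<Rightarrow> ('o, 'm, 'a) cmodule set \<Rightarrow> ('o \<Rightarrow> 'u set) \<Rightarrow> ('o, 'm, 'u) cmodule
     \<Rightarrow> bool" where
  "pure_submodule \<C> \<A> L M \<longleftrightarrow>
     submodule \<C> L M \<and>
     (sub_module L M, inclusion \<C> L, M, projection \<C> M L, quotient_module M L) \<in> purity \<C> \<A>"

definition nonzero_sub ::
  "('o, 'm) additive_cat \<Rightarrow> ('o \<Rightarrow> 'u set) \<Rightarrow> ('o, 'm, 'u) cmodule \<Rightarrow> bool" where
  "nonzero_sub \<C> P M \<longleftrightarrow> (\<exists>a\<in>Obj \<C>. P a \<noteq> {\<one>\<^bsub>grp M a\<^esub>})"

section \<open>The type of the bounding cardinal\<close>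

text \<open>
  HOL has no single type of all cardinals: a cardinal is a \<open>Card_order\<close> on some type. In
  ``for every \<open>\<lambda>\<close> there is \<open>\<kappa>\<close> such that for every module \<open>M\<close>'' the bound must not depend on the
  type \<open>'u\<close> in which the elements of \<open>M\<close> live; otherwise \<open>\<kappa>\<close> could exceed the size of that type
  and the claim would be vacuous. So \<open>\<kappa>\<close> is taken on a type built only from the types of the data
  fixed before it: the objects \<open>'o\<close> and morphisms \<open>'m\<close> of \<open>\<C>\<close>, the elements \<open>'a\<close> of the modules
  in \<open>\<A>\<close>, and the field \<open>'l\<close> of \<open>\<lambda>\<close>. A statement proved for all \<open>'u\<close> with such a \<open>\<kappa>\<close> is uniform
  in \<open>'u\<close>, since every such \<open>\<kappa>\<close> is at most the cardinality of this type.
\<close>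

type_synonym ('o, 'm, 'a, 'l) bound = "(nat + 'o + 'm + 'a + 'l) set set set"

end

theory Submission
  imports Defs
begin

text \<open>
  Let \<open>\<mu>\<close> be the cardinality of \<open>nat + 'o + 'm + 'a + 'l\<close>; the bound is \<open>\<kappa> = 2^2^2^\<mu>\<close>. In additive
  notation, the pure submodule is found as a set of differences \<open>x - \<phi>(x)\<close>, where \<open>\<phi>\<close> moves a small
  submodule to another place in \<open>M\<close> without changing cosets of \<open>L\<close>; this keeps the differences
  inside \<open>L\<close>.

  By a Loewenheim-Skolem argument (\<open>small_reflecting_submodule\<close>) there is a submodule \<open>B\<close> of \<open>M\<close> with at
  most \<open>2^2^\<mu>\<close> elements such that each submodule \<open>Q\<close> of \<open>M\<close> with at most \<open>2^\<mu>\<close> elements has a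
  homomorphism \<open>\<phi> : Q \<rightarrow> B\<close> which is the identity on \<open>Q \<inter> B\<close> and satisfies \<open>x - \<phi>(x) \<in> L\<close>. As \<open>|M| \<ge> \<kappa>\<close>,
  some \<open>x\<close> is not in \<open>B\<close>. The nonzero element \<open>x + B\<close> of \<open>M/B\<close> lies in a pure submodule of \<open>M/B\<close> which is
  the image of a submodule \<open>Q\<close> of \<open>M\<close> with at most \<open>2^\<mu>\<close> elements and \<open>x \<in> Q\<close> (\<open>small_pure_modulo\<close>). For
  the corresponding \<open>\<phi>\<close> put \<open>P = {y - \<phi>(y) | y \<in> Q}\<close>. Then \<open>P \<subseteq> L\<close>, and \<open>x - \<phi>(x) \<noteq> 0\<close> since \<open>x\<close> is not in
  \<open>B\<close>. Moreover \<open>P \<inter> B = 0\<close> and \<open>P + B = Q + B\<close>, so \<open>P\<close> is mapped isomorphically onto a pure submodule of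
  \<open>M/B\<close>. It follows that \<open>P\<close> is pure in \<open>M\<close>, for if a composite of two monomorphisms is pure, so is
  the first one (\<open>pure_difference_submodule\<close>).

  Both \<open>B\<close> and \<open>Q\<close> are closures under families of infinitary operations, whose size is bounded by
  counting terms (\<open>small_closed_set\<close>).
\<close>

section \<open>Cardinal arithmetic\<close>

lemma UNIV_ordLeq_iff_inj:
  "|UNIV :: 'x set| \<le>o |UNIV :: 'y set| \<longleftrightarrow> (\<exists>f :: 'x \<Rightarrow> 'y. inj f)"
  using card_of_ordLeq[of "UNIV :: 'x set" "UNIV :: 'y set"] by auto

lemma inj_UNIV_ordLeq: "inj (f :: 'x \<Rightarrow> 'y) \<Longrightarrow> |UNIV :: 'x set| \<le>o |UNIV :: 'y set|"
  using UNIV_ordLeq_iff_inj by blast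

lemma prod_ordLeq_infinite:
  assumes "infinite (UNIV :: 'k set)"
    and "|UNIV :: 'x set| \<le>o |UNIV :: 'k set|" and "|UNIV :: 'y set| \<le>o |UNIV :: 'k set|"
  shows "|UNIV :: ('x \<times> 'y) set| \<le>o |UNIV :: 'k set|"
  using card_of_Times_ordLeq_infinite_Field[OF _ assms(2,3) card_of_Card_order] assms(1)
  by (simp add: Field_card_of)

lemma sum_ordLeq_infinite:
  assumes "infinite (UNIV :: 'k set)"
    and "|UNIV :: 'x set| \<le>o |UNIV :: 'k set|" and "|UNIV :: 'y set| \<le>o |UNIV :: 'k set|"
  shows "|UNIV :: ('x + 'y) set| \<le>o |UNIV :: 'k set|"
  using card_of_Plus_ordLeq_infinite_Field[OF _ assms(2,3) card_of_Card_order] assms(1)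
  by (simp add: Field_card_of)

lemma nat_ordLeq_infinite: "infinite (UNIV :: 'k set) \<Longrightarrow> |UNIV :: nat set| \<le>o |UNIV :: 'k set|"
  by (simp add: infinite_iff_card_of_nat)

lemma option_ordLeq_infinite:
  assumes "infinite (UNIV :: 'k set)" and "|UNIV :: 'x set| \<le>o |UNIV :: 'k set|"
  shows "|UNIV :: 'x option set| \<le>o |UNIV :: 'k set|"
proof -
  have "inj (\<lambda>x :: 'x option. case x of None \<Rightarrow> Inl (0 :: nat) | Some y \<Rightarrow> Inr y)"
    by (auto simp: inj_def split: option.splits)
  from inj_UNIV_ordLeq[OF this] show ?thesis
    using sum_ordLeq_infinite[OF assms(1) nat_ordLeq_infinite[OF assms(1)] assms(2)] ordLeq_transitive by blast
qed

lemma list_ordLeq_infinite: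
  assumes inf: "infinite (UNIV :: 'k set)" and x: "|UNIV :: 'x set| \<le>o |UNIV :: 'k set|"
  shows "|UNIV :: 'x list set| \<le>o |UNIV :: 'k set|"
proof -
  have "|UNIV :: ('x \<times> 'k) option set| \<le>o |UNIV :: 'k set|"
    by (intro option_ordLeq_infinite prod_ordLeq_infinite inf x ordLeq_reflexive card_of_Well_order)
  then obtain h :: "('x \<times> 'k) option \<Rightarrow> 'k" where h: "inj h"
    using UNIV_ordLeq_iff_inj by blast
  define enc where "enc = rec_list (h None) (\<lambda>x _ k. h (Some (x, k)))"
  have enc: "enc [] = h None" "\<And>x xs. enc (x # xs) = h (Some (x, enc xs))"
    by (simp_all add: enc_def)
  have "enc xs = enc ys \<Longrightarrow> xs = ys" for xs ys
  proof (induction xs arbitrary: ys)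
    case Nil
    then show ?case by (cases ys) (auto simp: enc dest: injD[OF h])
  next
    case (Cons x xs)
    then show ?case by (cases ys) (auto simp: enc dest: injD[OF h])
  qed
  then show ?thesis by (intro inj_UNIV_ordLeq) (auto simp: inj_def)
qed

lemma ordLeq_set:
  assumes "|UNIV :: 'x set| \<le>o |UNIV :: 'k set|"
  shows "|UNIV :: 'x set| \<le>o |UNIV :: 'k set set|"
  using assms card_of_Pow[of "UNIV :: 'k set", unfolded Pow_UNIV] ordLeq_transitive ordLess_imp_ordLeq by blast

lemma set_ordLeq_set:
  assumes "|UNIV :: 'x set| \<le>o |UNIV :: 'k set|"
  shows "|UNIV :: 'x set set| \<le>o |UNIV :: 'k set set|"
proof -
  obtain f :: "'x \<Rightarrow> 'k" where "inj f" using assms UNIV_ordLeq_iff_inj by blast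
  then have "inj (image f)" by (simp add: inj_image_eq_iff inj_def)
  then show ?thesis by (rule inj_UNIV_ordLeq)
qed

lemma infinite_set: "infinite (UNIV :: 'k set) \<Longrightarrow> infinite (UNIV :: 'k set set)"
  by (simp add: Finite_Set.finite_set)

text \<open>
  This is \<open>(2\<^sup>k)\<^sup>k = 2\<^sup>k\<close>: a function with values in \<open>'k set\<close> is the relation between arguments and
  elements of the values.
\<close>

lemma fun_ordLeq_set:
  assumes inf: "infinite (UNIV :: 'k set)"
    and x: "|UNIV :: 'x set| \<le>o |UNIV :: 'k set|" and y: "|UNIV :: 'y set| \<le>o |UNIV :: 'k set set|"
  shows "|UNIV :: ('x \<Rightarrow> 'y) set| \<le>o |UNIV :: 'k set set|"
proof -
  obtain g :: "'y \<Rightarrow> 'k set" where g: "inj g" using y UNIV_ordLeq_iff_inj by blast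
  have "inj (\<lambda>f :: 'x \<Rightarrow> 'y. {(x, k). k \<in> g (f x)})"
  proof (rule injI)
    fix f f' :: "'x \<Rightarrow> 'y"
    assume eq: "{(x, k). k \<in> g (f x)} = {(x, k). k \<in> g (f' x)}"
    have "g (f x) = g (f' x)" for x
    proof -
      have "k \<in> g (f x) \<longleftrightarrow> k \<in> g (f' x)" for k using eq by (auto simp: set_eq_iff)
      then show ?thesis by blast
    qed
    then show "f = f'" using g by (auto simp: inj_def)
  qed
  then have "|UNIV :: ('x \<Rightarrow> 'y) set| \<le>o |UNIV :: ('x \<times> 'k) set set|" by (rule inj_UNIV_ordLeq)
  moreover have "|UNIV :: ('x \<times> 'k) set set| \<le>o |UNIV :: 'k set set|"
    by (intro set_ordLeq_set prod_ordLeq_infinite inf x ordLeq_reflexive card_of_Well_order)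
  ultimately show ?thesis by (rule ordLeq_transitive)
qed

section \<open>Closure under infinitary operations\<close>

text \<open>
  The terms in operations of arity \<open>'i\<close> that are labelled by \<open>'t\<close>. The values of all terms form the
  least set that contains the value of \<open>Leaf\<close> and is closed under the operations; counting terms
  therefore bounds this closure without iterating along an ordinal.
\<close>

datatype ('t, 'i) op_tree = Leaf | Node 't "'i \<Rightarrow> ('t, 'i) op_tree"

primrec op_value :: "'x \<Rightarrow> ('t \<Rightarrow> ('i \<Rightarrow> 'x) \<Rightarrow> 'x) \<Rightarrow> ('t, 'i) op_tree \<Rightarrow> 'x" where
  "op_value x0 op Leaf = x0"
| "op_value x0 op (Node t g) = op t (\<lambda>i. op_value x0 op (g i))"

primrec path_label :: "('t, 'i) op_tree \<Rightarrow> 'i list \<Rightarrow> 't option" where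
  "path_label Leaf = (\<lambda>p. None)"
| "path_label (Node t g) = (\<lambda>p. case p of [] \<Rightarrow> Some t | i # q \<Rightarrow> path_label (g i) q)"

text \<open>
  A term is determined by the labels found along its paths, and a path is a finite list of
  arguments. Hence there are at most as many terms as functions \<open>'i list \<Rightarrow> 't option\<close>.
\<close>

lemma inj_path_label: "inj path_label"
proof -
  have "path_label T = path_label T' \<Longrightarrow> T = T'" for T T' :: "('t, 'i) op_tree"
  proof (induction T arbitrary: T')
    case Leaf
    show ?case using fun_cong[OF Leaf.prems, of "[]"] by (cases T') auto
  next
    case (Node t g)
    obtain t' g' where T': "T' = Node t' g'"
      using fun_cong[OF Node.prems, of "[]"] by (cases T') auto
    note eq = Node.prems[unfolded T']
    have "t = t'" using fun_cong[OF eq, of "[]"] by simp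
    moreover have "g i = g' i" for i
    proof (rule Node.IH[OF rangeI], rule ext)
      fix q show "path_label (g i) q = path_label (g' i) q"
        using fun_cong[OF eq, of "i # q"] by simp
    qed
    ultimately show ?case by (auto simp: T')
  qed
  then show ?thesis by (auto simp: inj_def)
qed

lemma small_closed_set:
  fixes x0 :: 'x and op :: "'t \<Rightarrow> ('i \<Rightarrow> 'x) \<Rightarrow> 'x"
  assumes inf: "infinite (UNIV :: 'k set)"
    and i: "|UNIV :: 'i set| \<le>o |UNIV :: 'k set|" and t: "|UNIV :: 't set| \<le>o |UNIV :: 'k set set|"
  obtains C where "|C| \<le>o |UNIV :: 'k set set|" and "x0 \<in> C"
    and "\<And>t e. range e \<subseteq> C \<Longrightarrow> op t e \<in> C"
proof -
  define C where "C = range (op_value x0 op)"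
  have "|C| \<le>o |UNIV :: ('t, 'i) op_tree set|" unfolding C_def by (rule card_of_image)
  also have "|UNIV :: ('t, 'i) op_tree set| \<le>o |UNIV :: ('i list \<Rightarrow> 't option) set|"
    by (rule inj_UNIV_ordLeq[OF inj_path_label])
  also have "|UNIV :: ('i list \<Rightarrow> 't option) set| \<le>o |UNIV :: 'k set set|"
    by (intro fun_ordLeq_set list_ordLeq_infinite option_ordLeq_infinite infinite_set inf i t)
  finally have "|C| \<le>o |UNIV :: 'k set set|" .
  moreover have "x0 \<in> C" unfolding C_def by (rule range_eqI[of _ _ Leaf]) simp
  moreover have "op t e \<in> C" if "range e \<subseteq> C" for t e
  proof -
    have "\<forall>i. \<exists>T. e i = op_value x0 op T" using that by (auto simp: C_def)
    then obtain g where "\<And>i. e i = op_value x0 op (g i)" by metis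
    then have "e = (\<lambda>i. op_value x0 op (g i))" by blast
    then have "op t e = op_value x0 op (Node t g)" by simp
    then show ?thesis by (auto simp: C_def simp del: op_value.simps)
  qed
  ultimately show thesis by (rule that)
qed

section \<open>Modules, submodules and quotients\<close>

lemma module_group: "is_module \<C> X \<Longrightarrow> a \<in> Obj \<C> \<Longrightarrow> comm_group (grp X a)"
  by (simp add: is_module_def)

lemma act_hom:
  "is_module \<C> X \<Longrightarrow> a \<in> Obj \<C> \<Longrightarrow> b \<in> Obj \<C> \<Longrightarrow> f \<in> Mor \<C> a b
    \<Longrightarrow> act X a b f \<in> hom (grp X b) (grp X a)"
  by (simp add: is_module_def)

lemma act_closed:
  "is_module \<C> X \<Longrightarrow> a \<in> Obj \<C> \<Longrightarrow> b \<in> Obj \<C> \<Longrightarrow> f \<in> Mor \<C> a b \<Longrightarrow> x \<in> carrier (grp X b)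
    \<Longrightarrow> act X a b f x \<in> carrier (grp X a)"
  by (blast intro: hom_in_carrier act_hom)

lemma act_mult:
  "is_module \<C> X \<Longrightarrow> a \<in> Obj \<C> \<Longrightarrow> b \<in> Obj \<C> \<Longrightarrow> f \<in> Mor \<C> a b
    \<Longrightarrow> x \<in> carrier (grp X b) \<Longrightarrow> y \<in> carrier (grp X b)
    \<Longrightarrow> act X a b f (x \<otimes>\<^bsub>grp X b\<^esub> y) = act X a b f x \<otimes>\<^bsub>grp X a\<^esub> act X a b f y"
  by (blast intro: hom_mult act_hom)

lemma act_group_hom:
  assumes "is_module \<C> X" "a \<in> Obj \<C>" "b \<in> Obj \<C>" "f \<in> Mor \<C> a b"
  shows "group_hom (grp X b) (grp X a) (act X a b f)"
proof -
  interpret G: comm_group "grp X b" by (rule module_group[OF assms(1,3)])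
  interpret H: comm_group "grp X a" by (rule module_group[OF assms(1,2)])
  show ?thesis by unfold_locales (rule act_hom[OF assms])
qed

lemma act_one:
  "is_module \<C> X \<Longrightarrow> a \<in> Obj \<C> \<Longrightarrow> b \<in> Obj \<C> \<Longrightarrow> f \<in> Mor \<C> a b
    \<Longrightarrow> act X a b f \<one>\<^bsub>grp X b\<^esub> = \<one>\<^bsub>grp X a\<^esub>"
  by (rule group_hom.hom_one[OF act_group_hom])

lemma act_inv:
  "is_module \<C> X \<Longrightarrow> a \<in> Obj \<C> \<Longrightarrow> b \<in> Obj \<C> \<Longrightarrow> f \<in> Mor \<C> a b \<Longrightarrow> x \<in> carrier (grp X b)
    \<Longrightarrow> act X a b f (inv\<^bsub>grp X b\<^esub> x) = inv\<^bsub>grp X a\<^esub> (act X a b f x)"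
  by (rule group_hom.hom_inv[OF act_group_hom])

lemma submodule_subgroup: "submodule \<C> N X \<Longrightarrow> a \<in> Obj \<C> \<Longrightarrow> subgroup (N a) (grp X a)"
  by (simp add: submodule_def)

lemma submodule_mem:
  "submodule \<C> N X \<Longrightarrow> a \<in> Obj \<C> \<Longrightarrow> x \<in> N a \<Longrightarrow> x \<in> carrier (grp X a)"
  using submodule_subgroup subgroup.mem_carrier by metis

lemma submodule_one: "submodule \<C> N X \<Longrightarrow> a \<in> Obj \<C> \<Longrightarrow> \<one>\<^bsub>grp X a\<^esub> \<in> N a"
  using submodule_subgroup subgroup.one_closed by metis

lemma submodule_mult:
  "submodule \<C> N X \<Longrightarrow> a \<in> Obj \<C> \<Longrightarrow> x \<in> N a \<Longrightarrow> y \<in> N a \<Longrightarrow> x \<otimes>\<^bsub>grp X a\<^esub> y \<in> N a"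
  using submodule_subgroup subgroup.m_closed by metis

lemma submodule_inv: "submodule \<C> N X \<Longrightarrow> a \<in> Obj \<C> \<Longrightarrow> x \<in> N a \<Longrightarrow> inv\<^bsub>grp X a\<^esub> x \<in> N a"
  using submodule_subgroup subgroup.m_inv_closed by metis

lemma submodule_act:
  "submodule \<C> N X \<Longrightarrow> a \<in> Obj \<C> \<Longrightarrow> b \<in> Obj \<C> \<Longrightarrow> f \<in> Mor \<C> a b \<Longrightarrow> x \<in> N b
    \<Longrightarrow> act X a b f x \<in> N a"
  unfolding submodule_def by blast

lemma submodule_carrier: "is_module \<C> X \<Longrightarrow> submodule \<C> (\<lambda>a. carrier (grp X a)) X"
  unfolding submodule_def
  by (auto intro: group.subgroup_self comm_group.axioms(2) module_group act_closed)

lemma is_module_sub_module: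
  assumes X: "is_module \<C> X" and N: "submodule \<C> N X"
  shows "is_module \<C> (sub_module N X)"
proof -
  have "comm_group ((grp X a)\<lparr>carrier := N a\<rparr>)" if a: "a \<in> Obj \<C>" for a
  proof -
    interpret G: comm_group "grp X a" by (rule module_group[OF X a])
    interpret H: subgroup "N a" "grp X a" by (rule submodule_subgroup[OF N a])
    show ?thesis
      by (rule group.group_comm_groupI[OF H.subgroup_is_group[OF G.is_group]]) (simp add: G.m_comm)
  qed
  moreover have "act X a b f \<in> hom ((grp X b)\<lparr>carrier := N b\<rparr>) ((grp X a)\<lparr>carrier := N a\<rparr>)"
    if "a \<in> Obj \<C>" "b \<in> Obj \<C>" "f \<in> Mor \<C> a b" for a b f
    using submodule_act[OF N that] act_mult[OF X that] submodule_mem[OF N that(2)]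
    by (auto simp: hom_def)
  ultimately show ?thesis
    using X submodule_mem[OF N] unfolding is_module_def sub_module_def by simp
qed

lemma rcoset_eq_iff:
  assumes "comm_group G" "subgroup H G" "x \<in> carrier G" "y \<in> carrier G"
  shows "H #>\<^bsub>G\<^esub> x = H #>\<^bsub>G\<^esub> y \<longleftrightarrow> x \<otimes>\<^bsub>G\<^esub> inv\<^bsub>G\<^esub> y \<in> H"
proof -
  interpret comm_group G by fact
  interpret H: subgroup H G by fact
  show ?thesis
    using H.rcos_module[OF is_group assms(4,3)] repr_independence[OF _ assms(4,2)] rcos_self[OF assms(3,2)]
    by auto
qed

text \<open>
  The action on cosets in the quotient module was defined through the whole coset; on a
  representative it is the action of the module.
\<close>

lemma act_coset:
  assumes X: "is_module \<C> X" and N: "submodule \<C> N X"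
    and ab: "a \<in> Obj \<C>" "b \<in> Obj \<C>" "f \<in> Mor \<C> a b" and x: "x \<in> carrier (grp X b)"
  shows "act (quotient_module X N) a b f (N b #>\<^bsub>grp X b\<^esub> x) = N a #>\<^bsub>grp X a\<^esub> act X a b f x"
proof -
  interpret A: comm_group "grp X a" using module_group[OF X ab(1)] .
  interpret B: comm_group "grp X b" using module_group[OF X ab(2)] .
  note [simp] = submodule_mem[OF N ab(1)] submodule_mem[OF N ab(2)] act_closed[OF X ab] act_mult[OF X ab]
    x submodule_act[OF N ab] submodule_mult[OF N ab(1)]
  have one: "\<one>\<^bsub>grp X b\<^esub> \<in> N b" by (rule submodule_one[OF N ab(2)])
  have "(\<Union>h\<in>N a. \<Union>k\<in>N b. {h \<otimes>\<^bsub>grp X a\<^esub> act X a b f (k \<otimes>\<^bsub>grp X b\<^esub> x)})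
    = (\<Union>h\<in>N a. {h \<otimes>\<^bsub>grp X a\<^esub> act X a b f x})" (is "?l = ?r")
  proof
    show "?l \<subseteq> ?r"
    proof
      fix z assume "z \<in> ?l"
      then obtain h k where h: "h \<in> N a" and k: "k \<in> N b" and z: "z = h \<otimes>\<^bsub>grp X a\<^esub> act X a b f (k \<otimes>\<^bsub>grp X b\<^esub> x)"
        by blast
      have "z = (h \<otimes>\<^bsub>grp X a\<^esub> act X a b f k) \<otimes>\<^bsub>grp X a\<^esub> act X a b f x"
        using h k by (simp add: z A.m_assoc)
      moreover have "h \<otimes>\<^bsub>grp X a\<^esub> act X a b f k \<in> N a" using h k by simp
      ultimately show "z \<in> ?r" by blast
    qed
    show "?r \<subseteq> ?l"
    proof
      fix z assume "z \<in> ?r"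
      then obtain h where h: "h \<in> N a" and z: "z = h \<otimes>\<^bsub>grp X a\<^esub> act X a b f x" by blast
      have "z = h \<otimes>\<^bsub>grp X a\<^esub> act X a b f (\<one>\<^bsub>grp X b\<^esub> \<otimes>\<^bsub>grp X b\<^esub> x)" by (simp add: z)
      then show "z \<in> ?l" using h one by blast
    qed
  qed
  then show ?thesis by (simp add: quotient_module_def set_mult_def r_coset_def)
qed

lemma carrier_quotient:
  "carrier (grp (quotient_module X N) a) = (\<lambda>x. N a #>\<^bsub>grp X a\<^esub> x) ` carrier (grp X a)"
  by (simp add: quotient_module_def carrier_FactGroup)

lemma one_quotient: "\<one>\<^bsub>grp (quotient_module X N) a\<^esub> = N a"
  by (simp add: quotient_module_def)

lemma mult_quotient:
  assumes "is_module \<C> X" "submodule \<C> N X" "a \<in> Obj \<C>" "x \<in> carrier (grp X a)" "y \<in> carrier (grp X a)"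
  shows "(N a #>\<^bsub>grp X a\<^esub> x) \<otimes>\<^bsub>grp (quotient_module X N) a\<^esub> (N a #>\<^bsub>grp X a\<^esub> y)
    = N a #>\<^bsub>grp X a\<^esub> (x \<otimes>\<^bsub>grp X a\<^esub> y)"
proof -
  interpret G: comm_group "grp X a" by (rule module_group[OF assms(1,3)])
  have "N a \<lhd> grp X a" using submodule_subgroup[OF assms(2,3)] by (simp add: G.normal_iff_subgroup)
  then show ?thesis using assms(4,5) by (simp add: quotient_module_def normal.rcos_sum)
qed

lemma is_module_quotient:
  assumes C: "preadditive_category \<C>" and X: "is_module \<C> X" and N: "submodule \<C> N X"
  shows "is_module \<C> (quotient_module X N)"
proof -
  let ?Q = "quotient_module X N"
  have "comm_group (grp ?Q a)" if a: "a \<in> Obj \<C>" for a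
    using comm_group.abelian_FactGroup[OF module_group[OF X a] submodule_subgroup[OF N a]]
    by (simp add: quotient_module_def)
  moreover have "act ?Q a b f \<in> hom (grp ?Q b) (grp ?Q a)"
    if ab: "a \<in> Obj \<C>" "b \<in> Obj \<C>" "f \<in> Mor \<C> a b" for a b f
  proof (rule homI)
    fix Y assume "Y \<in> carrier (grp ?Q b)"
    then obtain y where y: "y \<in> carrier (grp X b)" "Y = N b #>\<^bsub>grp X b\<^esub> y"
      by (auto simp: carrier_quotient)
    show "act ?Q a b f Y \<in> carrier (grp ?Q a)"
      using act_closed[OF X ab y(1)] by (simp add: y(2) act_coset[OF X N ab y(1)] carrier_quotient)
    fix Z assume "Z \<in> carrier (grp ?Q b)"
    then obtain z where z: "z \<in> carrier (grp X b)" "Z = N b #>\<^bsub>grp X b\<^esub> z"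
      by (auto simp: carrier_quotient)
    have yz: "y \<otimes>\<^bsub>grp X b\<^esub> z \<in> carrier (grp X b)"
      using module_group[OF X ab(2)] y z by (simp add: comm_group_def comm_monoid_def monoid.m_closed)
    show "act ?Q a b f (Y \<otimes>\<^bsub>grp ?Q b\<^esub> Z) = act ?Q a b f Y \<otimes>\<^bsub>grp ?Q a\<^esub> act ?Q a b f Z"
      using act_closed[OF X ab] act_mult[OF X ab] y z yz
      by (simp add: mult_quotient[OF X N] ab act_coset[OF X N ab])
  qed
  moreover have "act ?Q a a (Idt \<C> a) Y = Y" if a: "a \<in> Obj \<C>" and Y: "Y \<in> carrier (grp ?Q a)" for a Y
  proof -
    obtain y where y: "y \<in> carrier (grp X a)" "Y = N a #>\<^bsub>grp X a\<^esub> y"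
      using Y by (auto simp: carrier_quotient)
    have I: "Idt \<C> a \<in> Mor \<C> a a" using C a by (simp add: preadditive_category_def category_def)
    show ?thesis using X a y by (simp add: act_coset[OF X N a a I] is_module_def)
  qed
  moreover have "act ?Q a c (Comp \<C> a b c g f) Y = act ?Q a b f (act ?Q b c g Y)"
    if abc: "a \<in> Obj \<C>" "b \<in> Obj \<C>" "c \<in> Obj \<C>" and f: "f \<in> Mor \<C> a b" and g: "g \<in> Mor \<C> b c"
      and Y: "Y \<in> carrier (grp ?Q c)" for a b c f g Y
  proof -
    obtain y where y: "y \<in> carrier (grp X c)" "Y = N c #>\<^bsub>grp X c\<^esub> y"
      using Y by (auto simp: carrier_quotient)
    have gf: "Comp \<C> a b c g f \<in> Mor \<C> a c"
      using C abc f g by (simp add: preadditive_category_def category_def)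
    have "act X a c (Comp \<C> a b c g f) y = act X a b f (act X b c g y)"
      using X abc f g y by (simp add: is_module_def)
    then show ?thesis using y act_closed[OF X abc(2,3) g]
      by (simp add: act_coset[OF X N abc(1,3) gf] act_coset[OF X N abc(2,3) g] act_coset[OF X N abc(1,2) f])
  qed
  moreover have "act ?Q a b (f \<otimes>\<^bsub>Hom \<C> a b\<^esub> g) Y = act ?Q a b f Y \<otimes>\<^bsub>grp ?Q a\<^esub> act ?Q a b g Y"
    if ab: "a \<in> Obj \<C>" "b \<in> Obj \<C>" and f: "f \<in> Mor \<C> a b" and g: "g \<in> Mor \<C> a b"
      and Y: "Y \<in> carrier (grp ?Q b)" for a b f g Y
  proof -
    obtain y where y: "y \<in> carrier (grp X b)" "Y = N b #>\<^bsub>grp X b\<^esub> y"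
      using Y by (auto simp: carrier_quotient)
    have "comm_group (Hom \<C> a b)" using C ab by (simp add: preadditive_category_def)
    then have fg: "f \<otimes>\<^bsub>Hom \<C> a b\<^esub> g \<in> Mor \<C> a b"
      using f g by (simp add: comm_group_def comm_monoid_def monoid.m_closed)
    have "act X a b (f \<otimes>\<^bsub>Hom \<C> a b\<^esub> g) y = act X a b f y \<otimes>\<^bsub>grp X a\<^esub> act X a b g y"
      using X ab f g y by (simp add: is_module_def)
    then show ?thesis using y act_closed[OF X ab f] act_closed[OF X ab g]
      by (simp add: act_coset[OF X N ab fg] act_coset[OF X N ab f] act_coset[OF X N ab g]
          mult_quotient[OF X N ab(1)])
  qed
  ultimately show ?thesis unfolding is_module_def by (intro conjI ballI) simp_all
qed

section \<open>Homomorphism groups and left exactness\<close>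

lemma restrict_module_hom:
  assumes X: "is_module \<C> X"
    and closed: "\<And>a x. a \<in> Obj \<C> \<Longrightarrow> x \<in> carrier (grp X a) \<Longrightarrow> g a x \<in> carrier (grp Y a)"
    and add: "\<And>a x y. a \<in> Obj \<C> \<Longrightarrow> x \<in> carrier (grp X a) \<Longrightarrow> y \<in> carrier (grp X a)
      \<Longrightarrow> g a (x \<otimes>\<^bsub>grp X a\<^esub> y) = g a x \<otimes>\<^bsub>grp Y a\<^esub> g a y"
    and nat: "\<And>a b f x. a \<in> Obj \<C> \<Longrightarrow> b \<in> Obj \<C> \<Longrightarrow> f \<in> Mor \<C> a b \<Longrightarrow> x \<in> carrier (grp X b)
      \<Longrightarrow> g a (act X a b f x) = act Y a b f (g b x)"
  shows "(\<lambda>a\<in>Obj \<C>. \<lambda>x\<in>carrier (grp X a). g a x) \<in> module_hom \<C> X Y"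
proof -
  have "x \<otimes>\<^bsub>grp X a\<^esub> y \<in> carrier (grp X a)"
    if "a \<in> Obj \<C>" "x \<in> carrier (grp X a)" "y \<in> carrier (grp X a)" for a x y
    using module_group[OF X that(1)] that by (simp add: comm_group_def comm_monoid_def monoid.m_closed)
  then show ?thesis
    using closed add nat act_closed[OF X] by (auto simp: module_hom_def hom_def)
qed

lemma module_hom_closed:
  "\<phi> \<in> module_hom \<C> X Y \<Longrightarrow> a \<in> Obj \<C> \<Longrightarrow> x \<in> carrier (grp X a) \<Longrightarrow> \<phi> a x \<in> carrier (grp Y a)"
  by (auto simp: module_hom_def PiE_def hom_def Pi_def)

lemma module_hom_mult:
  "\<phi> \<in> module_hom \<C> X Y \<Longrightarrow> a \<in> Obj \<C> \<Longrightarrow> x \<in> carrier (grp X a) \<Longrightarrow> y \<in> carrier (grp X a)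
    \<Longrightarrow> \<phi> a (x \<otimes>\<^bsub>grp X a\<^esub> y) = \<phi> a x \<otimes>\<^bsub>grp Y a\<^esub> \<phi> a y"
  by (auto simp: module_hom_def PiE_def hom_def Pi_def)

lemma module_hom_act:
  "\<phi> \<in> module_hom \<C> X Y \<Longrightarrow> a \<in> Obj \<C> \<Longrightarrow> b \<in> Obj \<C> \<Longrightarrow> f \<in> Mor \<C> a b \<Longrightarrow> x \<in> carrier (grp X b)
    \<Longrightarrow> \<phi> a (act X a b f x) = act Y a b f (\<phi> b x)"
  by (auto simp: module_hom_def)

lemma module_hom_hom: "\<phi> \<in> module_hom \<C> X Y \<Longrightarrow> a \<in> Obj \<C> \<Longrightarrow> \<phi> a \<in> hom (grp X a) (grp Y a)"
  by (auto simp: module_hom_def PiE_def Pi_def)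

lemma module_hom_eqI:
  assumes "\<phi> \<in> module_hom \<C> X Y" "\<psi> \<in> module_hom \<C> X Y"
    and "\<And>a x. a \<in> Obj \<C> \<Longrightarrow> x \<in> carrier (grp X a) \<Longrightarrow> \<phi> a x = \<psi> a x"
  shows "\<phi> = \<psi>"
proof (rule PiE_ext)
  show "\<phi> \<in> Obj \<C> \<rightarrow>\<^sub>E UNIV" "\<psi> \<in> Obj \<C> \<rightarrow>\<^sub>E UNIV"
    using assms(1,2) by (auto simp: module_hom_def PiE_def)
  fix a assume a: "a \<in> Obj \<C>"
  then have "\<phi> a \<in> extensional (carrier (grp X a))" "\<psi> a \<in> extensional (carrier (grp X a))"
    using assms(1,2) by (auto simp: module_hom_def PiE_def Pi_def)
  then show "\<phi> a = \<psi> a" by (rule extensionalityI) (rule assms(3)[OF a])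
qed

lemma mult_hom_group_apply:
  "a \<in> Obj \<C> \<Longrightarrow> x \<in> carrier (grp X a)
    \<Longrightarrow> (\<phi> \<otimes>\<^bsub>hom_group \<C> X Y\<^esub> \<psi>) a x = \<phi> a x \<otimes>\<^bsub>grp Y a\<^esub> \<psi> a x"
  by (simp add: hom_group_def)

lemma one_hom_group_apply:
  "a \<in> Obj \<C> \<Longrightarrow> x \<in> carrier (grp X a) \<Longrightarrow> \<one>\<^bsub>hom_group \<C> X Y\<^esub> a x = \<one>\<^bsub>grp Y a\<^esub>"
  by (simp add: hom_group_def)

lemma carrier_hom_group: "carrier (hom_group \<C> X Y) = module_hom \<C> X Y"
  by (simp add: hom_group_def)

lemma comm_group_hom_group:
  assumes X: "is_module \<C> X" and Y: "is_module \<C> Y"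
  shows "comm_group (hom_group \<C> X Y)"
proof (rule comm_groupI)
  note G = module_group[OF Y]
  have mon: "Group.monoid (grp Y a)" if "a \<in> Obj \<C>" for a
    using G[OF that] by (simp add: comm_group_def comm_monoid_def)
  have grp: "Group.group (grp Y a)" if "a \<in> Obj \<C>" for a
    using G[OF that] by (simp add: comm_group_def)
  have cmon: "comm_monoid (grp Y a)" if "a \<in> Obj \<C>" for a
    using G[OF that] by (simp add: comm_group_def)
  note cl = module_hom_closed monoid.m_closed[OF mon] group.inv_closed[OF grp] act_closed[OF Y]
  show mult: "\<phi> \<otimes>\<^bsub>hom_group \<C> X Y\<^esub> \<psi> \<in> carrier (hom_group \<C> X Y)"
    if "\<phi> \<in> carrier (hom_group \<C> X Y)" "\<psi> \<in> carrier (hom_group \<C> X Y)" for \<phi> \<psi>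
  proof -
    have "\<phi> \<otimes>\<^bsub>hom_group \<C> X Y\<^esub> \<psi> = (\<lambda>a\<in>Obj \<C>. \<lambda>x\<in>carrier (grp X a). \<phi> a x \<otimes>\<^bsub>grp Y a\<^esub> \<psi> a x)"
      by (simp add: hom_group_def)
    also have "\<dots> \<in> module_hom \<C> X Y" using that[unfolded carrier_hom_group]
      by (intro restrict_module_hom[OF X])
        (simp_all add: cl module_hom_mult module_hom_act act_mult[OF Y] comm_monoid.m_ac[OF cmon])
    finally show ?thesis by (simp add: carrier_hom_group)
  qed
  show one: "\<one>\<^bsub>hom_group \<C> X Y\<^esub> \<in> carrier (hom_group \<C> X Y)"
  proof -
    have "\<one>\<^bsub>hom_group \<C> X Y\<^esub> = (\<lambda>a\<in>Obj \<C>. \<lambda>x\<in>carrier (grp X a). \<one>\<^bsub>grp Y a\<^esub>)"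
      by (simp add: hom_group_def)
    also have "\<dots> \<in> module_hom \<C> X Y"
      by (intro restrict_module_hom[OF X])
        (simp_all add: cl act_one[OF Y] monoid.one_closed[OF mon] monoid.l_one[OF mon])
    finally show ?thesis by (simp add: carrier_hom_group)
  qed
  show "\<phi> \<otimes>\<^bsub>hom_group \<C> X Y\<^esub> \<psi> \<otimes>\<^bsub>hom_group \<C> X Y\<^esub> \<chi> = \<phi> \<otimes>\<^bsub>hom_group \<C> X Y\<^esub> (\<psi> \<otimes>\<^bsub>hom_group \<C> X Y\<^esub> \<chi>)"
    if "\<phi> \<in> carrier (hom_group \<C> X Y)" "\<psi> \<in> carrier (hom_group \<C> X Y)" "\<chi> \<in> carrier (hom_group \<C> X Y)"
    for \<phi> \<psi> \<chi>
    using that mult[unfolded carrier_hom_group] unfolding carrier_hom_group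
    by (intro module_hom_eqI[of _ \<C> X Y]) (simp_all add: cl mult_hom_group_apply monoid.m_assoc[OF mon])
  show "\<phi> \<otimes>\<^bsub>hom_group \<C> X Y\<^esub> \<psi> = \<psi> \<otimes>\<^bsub>hom_group \<C> X Y\<^esub> \<phi>"
    if "\<phi> \<in> carrier (hom_group \<C> X Y)" "\<psi> \<in> carrier (hom_group \<C> X Y)" for \<phi> \<psi>
    using that mult[unfolded carrier_hom_group] unfolding carrier_hom_group
    by (intro module_hom_eqI[of _ \<C> X Y]) (simp_all add: cl mult_hom_group_apply comm_monoid.m_comm[OF cmon])
  show "\<one>\<^bsub>hom_group \<C> X Y\<^esub> \<otimes>\<^bsub>hom_group \<C> X Y\<^esub> \<phi> = \<phi>"
    if "\<phi> \<in> carrier (hom_group \<C> X Y)" for \<phi>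
    using that one mult[unfolded carrier_hom_group] unfolding carrier_hom_group
    by (intro module_hom_eqI[of _ \<C> X Y])
      (simp_all add: cl mult_hom_group_apply one_hom_group_apply monoid.l_one[OF mon])
  show "\<exists>\<psi>\<in>carrier (hom_group \<C> X Y). \<psi> \<otimes>\<^bsub>hom_group \<C> X Y\<^esub> \<phi> = \<one>\<^bsub>hom_group \<C> X Y\<^esub>"
    if "\<phi> \<in> carrier (hom_group \<C> X Y)" for \<phi>
  proof
    let ?\<psi> = "\<lambda>a\<in>Obj \<C>. \<lambda>x\<in>carrier (grp X a). inv\<^bsub>grp Y a\<^esub> \<phi> a x"
    have phi: "\<phi> \<in> module_hom \<C> X Y" using that by (simp add: carrier_hom_group)
    show "?\<psi> \<in> carrier (hom_group \<C> X Y)"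
      unfolding carrier_hom_group
      by (intro restrict_module_hom[OF X])
        (simp_all add: module_hom_closed[OF phi] cl module_hom_mult[OF phi] module_hom_act[OF phi] act_inv[OF Y]
           comm_group.inv_mult[OF G])
    then show "?\<psi> \<otimes>\<^bsub>hom_group \<C> X Y\<^esub> \<phi> = \<one>\<^bsub>hom_group \<C> X Y\<^esub>"
      using that one mult unfolding carrier_hom_group
      by (intro module_hom_eqI[of _ \<C> X Y])
        (simp_all add: cl mult_hom_group_apply one_hom_group_apply group.l_inv[OF grp])
  qed
qed

lemma hom_map_apply:
  "a \<in> Obj \<C> \<Longrightarrow> x \<in> carrier (grp A a) \<Longrightarrow> hom_map \<C> A \<phi> \<alpha> a x = \<phi> a (\<alpha> a x)"
  by (simp add: hom_map_def compose_def)

lemma hom_map_closed: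
  assumes A: "is_module \<C> A" and phi: "\<phi> \<in> module_hom \<C> X Y" and alpha: "\<alpha> \<in> module_hom \<C> A X"
  shows "hom_map \<C> A \<phi> \<alpha> \<in> module_hom \<C> A Y"
  unfolding hom_map_def compose_def
  by (intro restrict_module_hom[OF A])
    (simp_all add: module_hom_closed[OF phi] module_hom_closed[OF alpha] module_hom_mult[OF phi]
      module_hom_mult[OF alpha] module_hom_act[OF phi] module_hom_act[OF alpha])

lemma hom_map_hom:
  assumes A: "is_module \<C> A" and X: "is_module \<C> X" and Y: "is_module \<C> Y" and phi: "\<phi> \<in> module_hom \<C> X Y"
  shows "hom_map \<C> A \<phi> \<in> hom (hom_group \<C> A X) (hom_group \<C> A Y)"
proof (rule homI)
  fix \<alpha> \<beta> assume *: "\<alpha> \<in> carrier (hom_group \<C> A X)" "\<beta> \<in> carrier (hom_group \<C> A X)"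
  then have alpha: "\<alpha> \<in> module_hom \<C> A X" and beta: "\<beta> \<in> module_hom \<C> A X"
    by (simp_all add: carrier_hom_group)
  show cl: "hom_map \<C> A \<phi> \<alpha> \<in> carrier (hom_group \<C> A Y)"
    using hom_map_closed[OF A phi alpha] by (simp add: carrier_hom_group)
  have "\<alpha> \<otimes>\<^bsub>hom_group \<C> A X\<^esub> \<beta> \<in> module_hom \<C> A X"
    using comm_group_hom_group[OF A X] * carrier_hom_group[of \<C> A X]
    by (metis comm_group_def comm_monoid_def monoid.m_closed)
  moreover have "hom_map \<C> A \<phi> \<alpha> \<otimes>\<^bsub>hom_group \<C> A Y\<^esub> hom_map \<C> A \<phi> \<beta> \<in> module_hom \<C> A Y"
    using comm_group_hom_group[OF A Y] hom_map_closed[OF A phi alpha] hom_map_closed[OF A phi beta]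
      carrier_hom_group[of \<C> A Y]
    by (metis comm_group_def comm_monoid_def monoid.m_closed)
  ultimately show "hom_map \<C> A \<phi> (\<alpha> \<otimes>\<^bsub>hom_group \<C> A X\<^esub> \<beta>)
      = hom_map \<C> A \<phi> \<alpha> \<otimes>\<^bsub>hom_group \<C> A Y\<^esub> hom_map \<C> A \<phi> \<beta>"
    by (intro module_hom_eqI[of _ \<C> A Y] hom_map_closed[OF A phi])
      (simp_all add: hom_map_apply mult_hom_group_apply module_hom_mult[OF phi] module_hom_closed[OF alpha]
        module_hom_closed[OF beta])
qed

text \<open>
  \<open>Hom(A, -)\<close> is left exact, so surjectivity of the last map is all that purity asks for.
  A homomorphism \<open>A \<rightarrow> Y\<close> killed by \<open>\<psi>\<close> takes values in the image of \<open>\<phi>\<close>, and as \<open>\<phi>\<close> is injective the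
  values can be pulled back to \<open>X\<close> in exactly one way, hence homomorphically.
\<close>

lemma hom_group_short_exact:
  assumes A: "is_module \<C> A" and ex: "mod_short_exact \<C> X \<phi> Y \<psi> Z"
    and lift: "\<And>\<gamma>. \<gamma> \<in> module_hom \<C> A Z \<Longrightarrow> \<exists>\<beta>\<in>module_hom \<C> A Y. hom_map \<C> A \<psi> \<beta> = \<gamma>"
  shows "ab_short_exact (hom_group \<C> A X) (hom_map \<C> A \<phi>) (hom_group \<C> A Y) (hom_map \<C> A \<psi>) (hom_group \<C> A Z)"
proof -
  have X: "is_module \<C> X" and Y: "is_module \<C> Y" and Z: "is_module \<C> Z"
    and phi: "\<phi> \<in> module_hom \<C> X Y" and psi: "\<psi> \<in> module_hom \<C> Y Z"
    using ex by (simp_all add: mod_short_exact_def)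
  have inj: "inj_on (\<phi> a) (carrier (grp X a))" and im: "\<phi> a ` carrier (grp X a) = kernel (grp Y a) (grp Z a) (\<psi> a)"
    if "a \<in> Obj \<C>" for a
    using ex that by (simp_all add: mod_short_exact_def ab_short_exact_def mon_def)
  have "inj_on (hom_map \<C> A \<phi>) (module_hom \<C> A X)"
  proof (rule inj_onI)
    fix \<alpha> \<beta> assume \<alpha>: "\<alpha> \<in> module_hom \<C> A X" and \<beta>: "\<beta> \<in> module_hom \<C> A X"
      and eq: "hom_map \<C> A \<phi> \<alpha> = hom_map \<C> A \<phi> \<beta>"
    show "\<alpha> = \<beta>"
    proof (rule module_hom_eqI[OF \<alpha> \<beta>])
      fix a x assume ax: "a \<in> Obj \<C>" "x \<in> carrier (grp A a)"
      have "\<phi> a (\<alpha> a x) = \<phi> a (\<beta> a x)" using fun_cong[OF fun_cong[OF eq, of a], of x] by (simp add: hom_map_apply ax)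
      then show "\<alpha> a x = \<beta> a x" using inj[OF ax(1)] module_hom_closed[OF \<alpha> ax] module_hom_closed[OF \<beta> ax]
        by (auto dest: inj_onD)
    qed
  qed
  moreover have "hom_map \<C> A \<phi> ` module_hom \<C> A X
      = kernel (hom_group \<C> A Y) (hom_group \<C> A Z) (hom_map \<C> A \<psi>)" (is "?I = ?K")
  proof
    show "?I \<subseteq> ?K"
    proof
      fix \<beta> assume "\<beta> \<in> ?I"
      then obtain \<alpha> where \<alpha>: "\<alpha> \<in> module_hom \<C> A X" and \<beta>: "\<beta> = hom_map \<C> A \<phi> \<alpha>" by blast
      have \<beta>': "\<beta> \<in> module_hom \<C> A Y" unfolding \<beta> by (rule hom_map_closed[OF A phi \<alpha>])
      have "hom_map \<C> A \<psi> \<beta> = \<one>\<^bsub>hom_group \<C> A Z\<^esub>"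
      proof (rule module_hom_eqI[of _ \<C> A Z])
        show "hom_map \<C> A \<psi> \<beta> \<in> module_hom \<C> A Z" by (rule hom_map_closed[OF A psi \<beta>'])
        show "\<one>\<^bsub>hom_group \<C> A Z\<^esub> \<in> module_hom \<C> A Z"
          using comm_group_hom_group[OF A Z] carrier_hom_group[of \<C> A Z]
          by (metis comm_group_def comm_monoid_def monoid.one_closed)
        fix a x assume ax: "a \<in> Obj \<C>" "x \<in> carrier (grp A a)"
        have "\<phi> a (\<alpha> a x) \<in> kernel (grp Y a) (grp Z a) (\<psi> a)"
          using im[OF ax(1)] module_hom_closed[OF \<alpha> ax] by blast
        then show "hom_map \<C> A \<psi> \<beta> a x = \<one>\<^bsub>hom_group \<C> A Z\<^esub> a x"
          by (simp add: hom_map_apply ax one_hom_group_apply \<beta> kernel_def)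
      qed
      then show "\<beta> \<in> ?K" using \<beta>' by (simp add: kernel_def carrier_hom_group)
    qed
    show "?K \<subseteq> ?I"
    proof
      fix \<beta> assume "\<beta> \<in> ?K"
      then have \<beta>: "\<beta> \<in> module_hom \<C> A Y" and eq: "hom_map \<C> A \<psi> \<beta> = \<one>\<^bsub>hom_group \<C> A Z\<^esub>"
        by (simp_all add: kernel_def carrier_hom_group)
      define r where "r a x = inv_into (carrier (grp X a)) (\<phi> a) (\<beta> a x)" for a x
      have r: "r a x \<in> carrier (grp X a)" "\<phi> a (r a x) = \<beta> a x" if ax: "a \<in> Obj \<C>" "x \<in> carrier (grp A a)" for a x
      proof -
        have "\<psi> a (\<beta> a x) = \<one>\<^bsub>grp Z a\<^esub>"
          using fun_cong[OF fun_cong[OF eq, of a], of x] by (simp add: hom_map_apply one_hom_group_apply ax)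
        then have "\<beta> a x \<in> \<phi> a ` carrier (grp X a)"
          using im[OF ax(1)] module_hom_closed[OF \<beta> ax] by (simp add: kernel_def)
        then show "r a x \<in> carrier (grp X a)" "\<phi> a (r a x) = \<beta> a x"
          by (simp_all add: r_def inv_into_into f_inv_into_f)
      qed
      have req: "r a x = y" if "a \<in> Obj \<C>" "x \<in> carrier (grp A a)" "y \<in> carrier (grp X a)" "\<phi> a y = \<beta> a x" for a x y
        using r[OF that(1,2)] that inj[OF that(1)] by (metis inj_onD)
      have mon: "Group.monoid (grp X a)" "Group.monoid (grp A a)" if "a \<in> Obj \<C>" for a
        using module_group[OF X that] module_group[OF A that] by (simp_all add: comm_group_def comm_monoid_def)
      have "(\<lambda>a\<in>Obj \<C>. \<lambda>x\<in>carrier (grp A a). r a x) \<in> module_hom \<C> A X" (is "?\<alpha> \<in> _")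
        by (intro restrict_module_hom[OF A] r req)
          (simp_all add: r monoid.m_closed mon module_hom_mult[OF phi] module_hom_mult[OF \<beta>]
            module_hom_act[OF phi] module_hom_act[OF \<beta>] act_closed[OF X] act_closed[OF A])
      moreover from this have "hom_map \<C> A \<phi> ?\<alpha> = \<beta>"
        by (intro module_hom_eqI[OF _ \<beta>] hom_map_closed[OF A phi]) (simp_all add: hom_map_apply r)
      ultimately show "\<beta> \<in> ?I" by blast
    qed
  qed
  moreover have "hom_map \<C> A \<psi> ` module_hom \<C> A Y = module_hom \<C> A Z"
    using lift hom_map_closed[OF A psi] by blast
  ultimately show ?thesis
    using comm_group_hom_group[OF A X] comm_group_hom_group[OF A Y] comm_group_hom_group[OF A Z]
      hom_map_hom[OF A X Y phi] hom_map_hom[OF A Y Z psi]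
    by (simp add: ab_short_exact_def mon_def epi_def carrier_hom_group)
qed

lemma submodule_short_exact:
  assumes C: "preadditive_category \<C>" and X: "is_module \<C> X" and N: "submodule \<C> N X"
  shows "mod_short_exact \<C> (sub_module N X) (inclusion \<C> N) X (projection \<C> X N) (quotient_module X N)"
proof -
  have S: "is_module \<C> (sub_module N X)" by (rule is_module_sub_module[OF X N])
  have Q: "is_module \<C> (quotient_module X N)" by (rule is_module_quotient[OF C X N])
  have cS: "carrier (grp (sub_module N X) a) = N a" "act (sub_module N X) = act X"
    "monoid.mult (grp (sub_module N X) a) = monoid.mult (grp X a)" for a
    by (simp_all add: sub_module_def)
  have i: "inclusion \<C> N \<in> module_hom \<C> (sub_module N X) X"
    using restrict_module_hom[OF S, of "\<lambda>a x. x" X] submodule_mem[OF N] unfolding cS inclusion_def by simp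
  have p: "projection \<C> X N \<in> module_hom \<C> X (quotient_module X N)"
    unfolding projection_def
    by (intro restrict_module_hom[OF X])
      (simp_all add: carrier_quotient mult_quotient[OF X N] act_coset[OF X N])
  have "ab_short_exact (grp (sub_module N X) a) (inclusion \<C> N a) (grp X a) (projection \<C> X N a)
      (grp (quotient_module X N) a)" if a: "a \<in> Obj \<C>" for a
  proof -
    interpret G: comm_group "grp X a" by (rule module_group[OF X a])
    have H: "subgroup (N a) (grp X a)" by (rule submodule_subgroup[OF N a])
    have "inclusion \<C> N a ` N a = kernel (grp X a) (grp (quotient_module X N) a) (projection \<C> X N a)"
      using G.coset_join1[OF _ _ H] G.coset_join2[OF _ H] submodule_mem[OF N a] a
      by (auto simp: inclusion_def projection_def kernel_def one_quotient)
    moreover have "inj_on (inclusion \<C> N a) (N a)" using a by (auto simp: inclusion_def inj_on_def)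
    moreover have "projection \<C> X N a ` carrier (grp X a) = carrier (grp (quotient_module X N) a)"
      using a by (simp add: projection_def carrier_quotient)
    ultimately show ?thesis
      using module_group[OF X a] module_group[OF S a] module_group[OF Q a] module_hom_hom[OF i a] module_hom_hom[OF p a]
      by (simp add: ab_short_exact_def mon_def epi_def cS)
  qed
  then show ?thesis using X S Q i p by (simp add: mod_short_exact_def)
qed

lemma pure_submoduleI:
  assumes C: "preadditive_category \<C>" and X: "is_module \<C> X" and N: "submodule \<C> N X"
    and mods: "\<forall>A\<in>\<A>. is_module \<C> A"
    and lift: "\<And>A \<gamma>. A \<in> \<A> \<Longrightarrow> \<gamma> \<in> module_hom \<C> A (quotient_module X N)
      \<Longrightarrow> \<exists>\<beta>\<in>module_hom \<C> A X. hom_map \<C> A (projection \<C> X N) \<beta> = \<gamma>"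
  shows "pure_submodule \<C> \<A> N X"
proof -
  have "ab_short_exact (hom_group \<C> A (sub_module N X)) (hom_map \<C> A (inclusion \<C> N)) (hom_group \<C> A X)
      (hom_map \<C> A (projection \<C> X N)) (hom_group \<C> A (quotient_module X N))" if "A \<in> \<A>" for A
    using mods that by (intro hom_group_short_exact[OF _ submodule_short_exact[OF C X N]] lift) auto
  then show ?thesis
    using submodule_short_exact[OF C X N] N by (simp add: pure_submodule_def purity_def)
qed

section \<open>Purity as solvability of defect equations\<close>

text \<open>
  Liftings of homomorphisms \<open>A \<rightarrow> M/N\<close> are studied through arbitrary families of maps \<open>s\<close> from \<open>A\<close> to
  \<open>M\<close>. A law is one instance of an identity that such a family has to satisfy in order to be a
  homomorphism, and its defect measures the failure. A family represents a homomorphism to \<open>M/N\<close>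
  if all its defects are in \<open>N\<close>, and the homomorphism lifts to \<open>M\<close> if some family in \<open>N\<close> has the same
  defects, since the defect is additive in the family. Laws play the role of the relations, and
  elements of \<open>A\<close> that of the generators, in a presentation of \<open>A\<close>.
\<close>

datatype ('o, 'm, 'a) law = Additive 'o 'a 'a | Natural 'o 'o 'm 'a

fun law_obj :: "('o, 'm, 'a) law \<Rightarrow> 'o" where
  "law_obj (Additive a x y) = a"
| "law_obj (Natural a b f x) = a"

definition laws :: "('o, 'm) additive_cat \<Rightarrow> ('o, 'm, 'a) cmodule \<Rightarrow> ('o, 'm, 'a) law set" where
  "laws \<C> A =
     {Additive a x y | a x y. a \<in> Obj \<C> \<and> x \<in> carrier (grp A a) \<and> y \<in> carrier (grp A a)} \<union>
     {Natural a b f x | a b f x. a \<in> Obj \<C> \<and> b \<in> Obj \<C> \<and> f \<in> Mor \<C> a b \<and> x \<in> carrier (grp A b)}"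

fun defect :: "('o, 'm, 'a) cmodule \<Rightarrow> ('o, 'm, 'u) cmodule \<Rightarrow> ('o \<Rightarrow> 'a \<Rightarrow> 'u) \<Rightarrow> ('o, 'm, 'a) law \<Rightarrow> 'u" where
  "defect A M s (Additive a x y) = s a (x \<otimes>\<^bsub>grp A a\<^esub> y) \<otimes>\<^bsub>grp M a\<^esub> inv\<^bsub>grp M a\<^esub> (s a x \<otimes>\<^bsub>grp M a\<^esub> s a y)"
| "defect A M s (Natural a b f x) = s a (act A a b f x) \<otimes>\<^bsub>grp M a\<^esub> inv\<^bsub>grp M a\<^esub> (act M a b f (s b x))"

definition family_in :: "('o, 'm) additive_cat \<Rightarrow> ('o, 'm, 'a) cmodule \<Rightarrow> ('o \<Rightarrow> 'u set) \<Rightarrow> ('o \<Rightarrow> 'a \<Rightarrow> 'u) \<Rightarrow> bool" where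
  "family_in \<C> A N s \<longleftrightarrow> (\<forall>a\<in>Obj \<C>. \<forall>x\<in>carrier (grp A a). s a x \<in> N a)"

abbreviation carr :: "('o, 'm, 'u) cmodule \<Rightarrow> 'o \<Rightarrow> 'u set" where
  "carr M \<equiv> \<lambda>a. carrier (grp M a)"

abbreviation diff :: "('o, 'm, 'u) cmodule \<Rightarrow> 'o \<Rightarrow> 'u \<Rightarrow> 'u \<Rightarrow> 'u" where
  "diff M a x y \<equiv> x \<otimes>\<^bsub>grp M a\<^esub> inv\<^bsub>grp M a\<^esub> y"

lemma family_inD: "family_in \<C> A N s \<Longrightarrow> a \<in> Obj \<C> \<Longrightarrow> x \<in> carrier (grp A a) \<Longrightarrow> s a x \<in> N a"
  by (simp add: family_in_def)

lemma law_obj_Obj: "l \<in> laws \<C> A \<Longrightarrow> law_obj l \<in> Obj \<C>"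
  by (auto simp: laws_def)

lemma laws_cases [consumes 1, case_names Additive Natural]:
  assumes "l \<in> laws \<C> A"
    and "\<And>a x y. l = Additive a x y \<Longrightarrow> a \<in> Obj \<C> \<Longrightarrow> x \<in> carrier (grp A a) \<Longrightarrow> y \<in> carrier (grp A a) \<Longrightarrow> P"
    and "\<And>a b f x. l = Natural a b f x \<Longrightarrow> a \<in> Obj \<C> \<Longrightarrow> b \<in> Obj \<C> \<Longrightarrow> f \<in> Mor \<C> a b \<Longrightarrow> x \<in> carrier (grp A b) \<Longrightarrow> P"
  shows P
  using assms by (auto simp: laws_def)

lemma defect_closed:
  assumes A: "is_module \<C> A" and N: "submodule \<C> N M"
    and s: "family_in \<C> A N s" and l: "l \<in> laws \<C> A"
  shows "defect A M s l \<in> N (law_obj l)"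
  using l
proof (cases rule: laws_cases)
  case (Additive a x y)
  interpret A: comm_group "grp A a" by (rule module_group[OF A Additive(2)])
  show ?thesis using Additive
    by (simp add: family_inD[OF s] submodule_mult[OF N] submodule_inv[OF N])
next
  case (Natural a b f x)
  show ?thesis using Natural
    by (simp add: family_inD[OF s] submodule_mult[OF N] submodule_inv[OF N] submodule_act[OF N] act_closed[OF A])
qed

text \<open>
  All target groups are commutative and the actions are additive, so the defect is additive in the
  family. This reduces congruences between defects to membership of a single defect.
\<close>

lemma defect_diff:
  assumes A: "is_module \<C> A" and M: "is_module \<C> M"
    and s: "family_in \<C> A (carr M) s" and t: "family_in \<C> A (carr M) t" and l: "l \<in> laws \<C> A"
  shows "defect A M (\<lambda>a x. diff M a (s a x) (t a x)) l = diff M (law_obj l) (defect A M s l) (defect A M t l)"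
  using l
proof (cases rule: laws_cases)
  case (Additive a x y)
  interpret A: comm_group "grp A a" by (rule module_group[OF A Additive(2)])
  interpret M: comm_group "grp M a" by (rule module_group[OF M Additive(2)])
  show ?thesis using Additive family_inD[OF s Additive(2)] family_inD[OF t Additive(2)]
    by (simp add: M.inv_mult M.m_ac)
next
  case (Natural a b f x)
  interpret M: comm_group "grp M a" by (rule module_group[OF M Natural(2)])
  interpret M': comm_group "grp M b" by (rule module_group[OF M Natural(3)])
  show ?thesis
    using Natural family_inD[OF s Natural(2)] family_inD[OF t Natural(2)]
      family_inD[OF s Natural(3)] family_inD[OF t Natural(3)] 
    by (simp add: act_mult[OF M] act_inv[OF M] act_closed[OF M] act_closed[OF A] M.inv_mult M.m_ac)
qed

lemma family_in_diff:
  assumes N: "submodule \<C> N M" and s: "family_in \<C> A N s" and t: "family_in \<C> A N t"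
  shows "family_in \<C> A N (\<lambda>a x. diff M a (s a x) (t a x))"
  using family_inD[OF s] family_inD[OF t] submodule_mult[OF N] submodule_inv[OF N]
  by (simp add: family_in_def)

lemma family_in_carr: "submodule \<C> N M \<Longrightarrow> family_in \<C> A N s \<Longrightarrow> family_in \<C> A (carr M) s"
  using submodule_mem by (fastforce simp: family_in_def)

lemma defect_cong:
  assumes A: "is_module \<C> A" and M: "is_module \<C> M" and B: "submodule \<C> B M"
    and s: "family_in \<C> A (carr M) s" and t: "family_in \<C> A (carr M) t" 
    and st: "family_in \<C> A B (\<lambda>a x. diff M a (s a x) (t a x))" and l: "l \<in> laws \<C> A"
  shows "diff M (law_obj l) (defect A M s l) (defect A M t l) \<in> B (law_obj l)"
  using defect_closed[OF A B st l] by (simp add: defect_diff[OF A M s t l])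

lemma diff_trans:
  assumes M: "is_module \<C> M" and B: "submodule \<C> B M" and a: "a \<in> Obj \<C>"
    and "x \<in> carrier (grp M a)" "y \<in> carrier (grp M a)" "z \<in> carrier (grp M a)"
    and "diff M a x y \<in> B a" "diff M a y z \<in> B a"
  shows "diff M a x z \<in> B a"
proof -
  interpret M: comm_group "grp M a" by (rule module_group[OF M a])
  have "diff M a x z = diff M a x y \<otimes>\<^bsub>grp M a\<^esub> diff M a y z"
    using assms(4-6) by (simp add: M.m_assoc) (simp add: M.m_assoc[symmetric])
  then show ?thesis using submodule_mult[OF B a assms(7,8)] by simp
qed

lemma diff_sym:
  assumes M: "is_module \<C> M" and B: "submodule \<C> B M" and a: "a \<in> Obj \<C>"
    and "x \<in> carrier (grp M a)" "y \<in> carrier (grp M a)" and "diff M a x y \<in> B a"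
  shows "diff M a y x \<in> B a"
proof -
  interpret M: comm_group "grp M a" by (rule module_group[OF M a])
  have "diff M a y x = inv\<^bsub>grp M a\<^esub> (diff M a x y)" using assms(4,5) by (simp add: M.inv_mult M.m_comm)
  then show ?thesis using submodule_inv[OF B a assms(6)] by simp
qed

text \<open>
  If \<open>B\<close> and \<open>N\<close> are submodules, this says that \<open>(N + B)/B\<close>, the image of \<open>N\<close> in \<open>M/B\<close>, is pure there:
  defects prescribed in \<open>N\<close> that are attained modulo \<open>B\<close> by some family in \<open>M\<close> are attained modulo \<open>B\<close>
  by a family in \<open>N\<close>. It is stated with representatives so that no quotient has to be formed.
\<close>

definition pure_modulo ::
  "('o, 'm) additive_cat \<Rightarrow> ('o, 'm, 'a) cmodule set \<Rightarrow> ('o \<Rightarrow> 'u set) \<Rightarrow> ('o \<Rightarrow> 'u set) \<Rightarrow> ('o, 'm, 'u) cmodule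
     \<Rightarrow> bool" where
  "pure_modulo \<C> \<A> B N M \<longleftrightarrow>
     (\<forall>A\<in>\<A>. \<forall>s d. family_in \<C> A (carr M) s \<and>
        (\<forall>l\<in>laws \<C> A. d l \<in> N (law_obj l) \<and> diff M (law_obj l) (defect A M s l) (d l) \<in> B (law_obj l)) \<longrightarrow>
        (\<exists>p. family_in \<C> A N p \<and>
           (\<forall>l\<in>laws \<C> A. diff M (law_obj l) (defect A M p l) (d l) \<in> B (law_obj l))))"

lemma pure_moduloD:
  assumes "pure_modulo \<C> \<A> B N M" "A \<in> \<A>" "family_in \<C> A (carr M) s"
    and "\<And>l. l \<in> laws \<C> A \<Longrightarrow> d l \<in> N (law_obj l)"
    and "\<And>l. l \<in> laws \<C> A \<Longrightarrow> diff M (law_obj l) (defect A M s l) (d l) \<in> B (law_obj l)"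
  shows "\<exists>p. family_in \<C> A N p \<and>
    (\<forall>l\<in>laws \<C> A. diff M (law_obj l) (defect A M p l) (d l) \<in> B (law_obj l))"
  using assms(1)[unfolded pure_modulo_def, rule_format, OF assms(2), of s d] assms(3-5) by blast

text \<open>
  Purity modulo \<open>B\<close> is a property of the image in \<open>M/B\<close>, and the two submodules have the same image.
\<close>

lemma pure_modulo_transfer:
  assumes M: "is_module \<C> M" and mods: "\<forall>A\<in>\<A>. is_module \<C> A"
    and B: "submodule \<C> B M" and N: "submodule \<C> N M" and N': "submodule \<C> N' M"
    and NN': "\<And>a x. a \<in> Obj \<C> \<Longrightarrow> x \<in> N a \<Longrightarrow> \<exists>y\<in>N' a. diff M a x y \<in> B a"
    and N'N: "\<And>a y. a \<in> Obj \<C> \<Longrightarrow> y \<in> N' a \<Longrightarrow> \<exists>x\<in>N a. diff M a x y \<in> B a"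
    and pure: "pure_modulo \<C> \<A> B N M"
  shows "pure_modulo \<C> \<A> B N' M"
  unfolding pure_modulo_def
proof (intro ballI allI impI, elim conjE)
  fix A s d'
  assume A: "A \<in> \<A>" and s: "family_in \<C> A (carr M) s"
    and d': "\<forall>l\<in>laws \<C> A. d' l \<in> N' (law_obj l) \<and> diff M (law_obj l) (defect A M s l) (d' l) \<in> B (law_obj l)"
  have A': "is_module \<C> A" using mods A by blast
  note carr = submodule_mem[OF N] submodule_mem[OF N']
  have "\<forall>l\<in>laws \<C> A. \<exists>x\<in>N (law_obj l). diff M (law_obj l) x (d' l) \<in> B (law_obj l)"
    using d' N'N law_obj_Obj by blast
  then obtain d where d: "\<And>l. l \<in> laws \<C> A \<Longrightarrow> d l \<in> N (law_obj l)"
    "\<And>l. l \<in> laws \<C> A \<Longrightarrow> diff M (law_obj l) (d l) (d' l) \<in> B (law_obj l)" by metis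
  have sc: "defect A M s l \<in> carrier (grp M (law_obj l))" if "l \<in> laws \<C> A" for l
    by (rule defect_closed[OF A' submodule_carrier[OF M] s that])
  have sd: "diff M (law_obj l) (defect A M s l) (d l) \<in> B (law_obj l)" if l: "l \<in> laws \<C> A" for l
  proof -
    note lo = law_obj_Obj[OF l]
    have "diff M (law_obj l) (d' l) (d l) \<in> B (law_obj l)"
      using diff_sym[OF M B lo _ _ d(2)[OF l]] carr[OF lo] d(1)[OF l] d' l by blast
    then show ?thesis
      using diff_trans[OF M B lo sc[OF l], of "d' l" "d l"] carr[OF lo] d(1)[OF l] d' l by blast
  qed
  obtain p where p: "family_in \<C> A N p"
    and pd: "\<And>l. l \<in> laws \<C> A \<Longrightarrow> diff M (law_obj l) (defect A M p l) (d l) \<in> B (law_obj l)"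
    using pure_moduloD[OF pure A s d(1) sd] by blast
  have "\<forall>a\<in>Obj \<C>. \<forall>x\<in>carrier (grp A a). \<exists>y\<in>N' a. diff M a (p a x) y \<in> B a"
    using NN' family_inD[OF p] by blast
  then obtain p' where p': "family_in \<C> A N' p'" and pp': "family_in \<C> A B (\<lambda>a x. diff M a (p a x) (p' a x))"
    unfolding family_in_def by metis
  have pc: "family_in \<C> A (carr M) p" "family_in \<C> A (carr M) p'"
    using family_in_carr[OF N p] family_in_carr[OF N' p'] .
  have "diff M (law_obj l) (defect A M p' l) (d' l) \<in> B (law_obj l)" if l: "l \<in> laws \<C> A" for l
  proof -
    note lo = law_obj_Obj[OF l]
    note c1 = defect_closed[OF A' submodule_carrier[OF M] pc(1) l]
    note c2 = defect_closed[OF A' submodule_carrier[OF M] pc(2) l]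
    have c3: "d l \<in> carrier (grp M (law_obj l))" "d' l \<in> carrier (grp M (law_obj l))"
      using carr[OF lo] d(1)[OF l] d' l by blast+
    have "diff M (law_obj l) (defect A M p' l) (defect A M p l) \<in> B (law_obj l)"
      by (rule diff_sym[OF M B lo c1 c2 defect_cong[OF A' M B pc pp' l]])
    then have "diff M (law_obj l) (defect A M p' l) (d l) \<in> B (law_obj l)"
      using diff_trans[OF M B lo c2 c1 c3(1)] pd[OF l] by blast
    then show ?thesis using diff_trans[OF M B lo c2 c3] d(2)[OF l] by blast
  qed
  then show "\<exists>p. family_in \<C> A N' p \<and>
           (\<forall>l\<in>laws \<C> A. diff M (law_obj l) (defect A M p l) (d' l) \<in> B (law_obj l))"
    using p' by blast
qed

lemma diff_eq_one:
  assumes "is_module \<C> M" "a \<in> Obj \<C>" "x \<in> carrier (grp M a)" "y \<in> carrier (grp M a)"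
    and "diff M a x y = \<one>\<^bsub>grp M a\<^esub>"
  shows "x = y"
proof -
  interpret M: comm_group "grp M a" by (rule module_group[OF assms(1,2)])
  show ?thesis using assms(3-5) M.inv_equality[of x "inv\<^bsub>grp M a\<^esub> y"] by simp
qed

text \<open>
  If \<open>N\<close> meets \<open>B\<close> trivially, then \<open>N\<close> is mapped isomorphically onto its image in \<open>M/B\<close>. A family in \<open>N\<close>
  which has the required defects modulo \<open>B\<close> then has them exactly, because the difference of two
  elements of \<open>N\<close> that agree modulo \<open>B\<close> lies in \<open>N \<inter> B\<close>.
\<close>

lemma pure_submodule_if_pure_modulo:
  assumes C: "preadditive_category \<C>" and M: "is_module \<C> M" and mods: "\<forall>A\<in>\<A>. is_module \<C> A"
    and B: "submodule \<C> B M" and N: "submodule \<C> N M"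
    and disj: "\<And>a x. a \<in> Obj \<C> \<Longrightarrow> x \<in> N a \<Longrightarrow> x \<in> B a \<Longrightarrow> x = \<one>\<^bsub>grp M a\<^esub>"
    and pure: "pure_modulo \<C> \<A> B N M"
  shows "pure_submodule \<C> \<A> N M"
proof (rule pure_submoduleI[OF C M N mods])
  fix A \<gamma> assume A: "A \<in> \<A>" and \<gamma>: "\<gamma> \<in> module_hom \<C> A (quotient_module M N)"
  have A': "is_module \<C> A" using mods A by blast
  note Ns = submodule_subgroup[OF N]
  have "\<forall>a\<in>Obj \<C>. \<forall>x\<in>carrier (grp A a). \<exists>y\<in>carrier (grp M a). \<gamma> a x = N a #>\<^bsub>grp M a\<^esub> y"
    using module_hom_closed[OF \<gamma>] unfolding carrier_quotient by blast
  then obtain s where s: "family_in \<C> A (carr M) s"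
    and \<gamma>s: "\<And>a x. a \<in> Obj \<C> \<Longrightarrow> x \<in> carrier (grp A a) \<Longrightarrow> \<gamma> a x = N a #>\<^bsub>grp M a\<^esub> s a x"
    unfolding family_in_def by metis
  note sc = family_inD[OF s]
  have sN: "defect A M s l \<in> N (law_obj l)" if "l \<in> laws \<C> A" for l
    using that
  proof (cases rule: laws_cases)
    case (Additive a x y)
    interpret A: comm_group "grp A a" by (rule module_group[OF A' Additive(2)])
    interpret M: comm_group "grp M a" by (rule module_group[OF M Additive(2)])
    have "N a #>\<^bsub>grp M a\<^esub> s a (x \<otimes>\<^bsub>grp A a\<^esub> y) = N a #>\<^bsub>grp M a\<^esub> (s a x \<otimes>\<^bsub>grp M a\<^esub> s a y)"
      using Additive module_hom_mult[OF \<gamma> Additive(2-4)] sc[OF Additive(2)]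
      by (simp add: \<gamma>s mult_quotient[OF M N])
    then show ?thesis
      using Additive sc[OF Additive(2)] rcoset_eq_iff[OF module_group[OF M Additive(2)] Ns[OF Additive(2)]] by simp
  next
    case (Natural a b f x)
    interpret M: comm_group "grp M a" by (rule module_group[OF M Natural(2)])
    have "N a #>\<^bsub>grp M a\<^esub> s a (act A a b f x) = N a #>\<^bsub>grp M a\<^esub> act M a b f (s b x)"
      using Natural module_hom_act[OF \<gamma> Natural(2-5)] sc[OF Natural(3)] act_closed[OF A' Natural(2-5)]
      by (simp add: \<gamma>s act_coset[OF M N])
    then show ?thesis
      using Natural sc act_closed[OF A' Natural(2-5)] act_closed[OF M Natural(2-4)]
        rcoset_eq_iff[OF module_group[OF M Natural(2)] Ns[OF Natural(2)]] by simp
  qed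
  have ss: "diff M (law_obj l) (defect A M s l) (defect A M s l) \<in> B (law_obj l)" if l: "l \<in> laws \<C> A" for l
  proof -
    interpret M: comm_group "grp M (law_obj l)" by (rule module_group[OF M law_obj_Obj[OF l]])
    show ?thesis
      using submodule_mem[OF N law_obj_Obj[OF l] sN[OF l]] submodule_one[OF B law_obj_Obj[OF l]] by simp
  qed
  obtain p where p: "family_in \<C> A N p"
    and pd: "\<And>l. l \<in> laws \<C> A \<Longrightarrow> diff M (law_obj l) (defect A M p l) (defect A M s l) \<in> B (law_obj l)"
    using pure_moduloD[OF pure A s sN ss] by blast
  note pc = family_in_carr[OF N p]
  let ?g = "\<lambda>a x. diff M a (s a x) (p a x)"
  have g: "family_in \<C> A (carr M) ?g" by (rule family_in_diff[OF submodule_carrier[OF M] s pc])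
  note gc = family_inD[OF g]
  have g1: "defect A M ?g l = \<one>\<^bsub>grp M (law_obj l)\<^esub>" if l: "l \<in> laws \<C> A" for l
  proof -
    note lo = law_obj_Obj[OF l]
    interpret M: comm_group "grp M (law_obj l)" by (rule module_group[OF M lo])
    have pN: "defect A M p l \<in> N (law_obj l)" by (rule defect_closed[OF A' N p l])
    have "diff M (law_obj l) (defect A M p l) (defect A M s l) \<in> N (law_obj l)"
      by (intro submodule_mult[OF N] submodule_inv[OF N] lo pN sN[OF l])
    then have "diff M (law_obj l) (defect A M p l) (defect A M s l) = \<one>\<^bsub>grp M (law_obj l)\<^esub>"
      using disj lo pd[OF l] by blast
    then have "defect A M p l = defect A M s l"
      using diff_eq_one[OF M lo] submodule_mem[OF N lo] pN sN[OF l] by blast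
    then show ?thesis using submodule_mem[OF N lo pN] by (simp add: defect_diff[OF A' M s pc l])
  qed
  have mon: "Group.monoid (grp M a)" "Group.monoid (grp A a)" if "a \<in> Obj \<C>" for a
    using module_group[OF M that] module_group[OF A' that] by (simp_all add: comm_group_def comm_monoid_def)
  have beta: "(\<lambda>a\<in>Obj \<C>. \<lambda>x\<in>carrier (grp A a). ?g a x) \<in> module_hom \<C> A M" (is "?\<beta> \<in> _")
  proof (rule restrict_module_hom[OF A' gc])
    fix a x y assume axy: "a \<in> Obj \<C>" "x \<in> carrier (grp A a)" "y \<in> carrier (grp A a)"
    then have "Additive a x y \<in> laws \<C> A" by (auto simp: laws_def)
    from g1[OF this, unfolded defect.simps law_obj.simps] show "?g a (x \<otimes>\<^bsub>grp A a\<^esub> y) = ?g a x \<otimes>\<^bsub>grp M a\<^esub> ?g a y"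
      by (rule diff_eq_one[OF M axy(1) gc[OF axy(1) monoid.m_closed[OF mon(2)[OF axy(1)] axy(2,3)]]
          monoid.m_closed[OF mon(1)[OF axy(1)] gc[OF axy(1,2)] gc[OF axy(1,3)]]])
  next
    fix a b f x assume ax: "a \<in> Obj \<C>" "b \<in> Obj \<C>" "f \<in> Mor \<C> a b" "x \<in> carrier (grp A b)"
    then have "Natural a b f x \<in> laws \<C> A" by (auto simp: laws_def)
    from g1[OF this, unfolded defect.simps law_obj.simps] show "?g a (act A a b f x) = act M a b f (?g b x)"
      by (rule diff_eq_one[OF M ax(1) gc[OF ax(1) act_closed[OF A' ax]] act_closed[OF M ax(1-3) gc[OF ax(2,4)]]])
  qed
  moreover have "hom_map \<C> A (projection \<C> M N) ?\<beta> = \<gamma>"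
  proof (rule module_hom_eqI[OF _ \<gamma>])
    show "hom_map \<C> A (projection \<C> M N) ?\<beta> \<in> module_hom \<C> A (quotient_module M N)"
      using submodule_short_exact[OF C M N] by (intro hom_map_closed[OF A' _ beta]) (simp add: mod_short_exact_def)
    fix a x assume ax: "a \<in> Obj \<C>" "x \<in> carrier (grp A a)"
    interpret M: comm_group "grp M a" by (rule module_group[OF M ax(1)])
    have "diff M a (?g a x) (s a x) = inv\<^bsub>grp M a\<^esub> p a x"
      using sc[OF ax] family_inD[OF pc ax] by (simp add: M.m_comm M.m_assoc[symmetric])
    also have "\<dots> \<in> N a" using submodule_inv[OF N ax(1) family_inD[OF p ax]] .
    finally have "N a #>\<^bsub>grp M a\<^esub> ?g a x = N a #>\<^bsub>grp M a\<^esub> s a x"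
      using rcoset_eq_iff[OF module_group[OF M ax(1)] Ns[OF ax(1)] gc[OF ax] sc[OF ax]] by blast
    then show "hom_map \<C> A (projection \<C> M N) ?\<beta> a x = \<gamma> a x"
      using gc[OF ax] by (simp add: hom_map_apply ax \<gamma>s projection_def)
  qed
  ultimately show "\<exists>\<beta>\<in>module_hom \<C> A M. hom_map \<C> A (projection \<C> M N) \<beta> = \<gamma>" by blast
qed

section \<open>Small submodules with prescribed closure properties\<close>

datatype ('o, 'm, 't) module_op = Zero 'o | Diff | Act 'o 'm | Extra 't

lemma module_op_ordLeq:
  assumes inf: "infinite (UNIV :: 'k set)"
    and "|UNIV :: 'o set| \<le>o |UNIV :: 'k set|" and "|UNIV :: 'm set| \<le>o |UNIV :: 'k set|"
    and "|UNIV :: 't set| \<le>o |UNIV :: 'k set|"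
  shows "|UNIV :: ('o, 'm, 't) module_op set| \<le>o |UNIV :: 'k set|"
proof -
  define h :: "('o, 'm, 't) module_op \<Rightarrow> ('o + nat) + (('o \<times> 'm) + 't)" where
    "h op = (case op of Zero a \<Rightarrow> Inl (Inl a) | Diff \<Rightarrow> Inl (Inr 0) | Act a f \<Rightarrow> Inr (Inl (a, f))
      | Extra t \<Rightarrow> Inr (Inr t))" for op
  have "inj h" by (auto simp: inj_def h_def split: module_op.splits)
  then have "|UNIV :: ('o, 'm, 't) module_op set| \<le>o |UNIV :: (('o + nat) + (('o \<times> 'm) + 't)) set|"
    by (rule inj_UNIV_ordLeq)
  also have "|UNIV :: (('o + nat) + (('o \<times> 'm) + 't)) set| \<le>o |UNIV :: 'k set|"
    by (intro sum_ordLeq_infinite prod_ordLeq_infinite nat_ordLeq_infinite assms)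
  finally show ?thesis .
qed

lemma law_ordLeq:
  assumes inf: "infinite (UNIV :: 'k set)"
    and "|UNIV :: 'o set| \<le>o |UNIV :: 'k set|" and "|UNIV :: 'm set| \<le>o |UNIV :: 'k set|"
    and "|UNIV :: 'a set| \<le>o |UNIV :: 'k set|"
  shows "|UNIV :: ('o, 'm, 'a) law set| \<le>o |UNIV :: 'k set|"
proof -
  define h :: "('o, 'm, 'a) law \<Rightarrow> ('o \<times> 'a \<times> 'a) + ('o \<times> 'o \<times> 'm \<times> 'a)" where
    "h l = (case l of Additive a x y \<Rightarrow> Inl (a, x, y) | Natural a b f x \<Rightarrow> Inr (a, b, f, x))" for l
  have "inj h" by (auto simp: inj_def h_def split: law.splits)
  then have "|UNIV :: ('o, 'm, 'a) law set| \<le>o |UNIV :: (('o \<times> 'a \<times> 'a) + ('o \<times> 'o \<times> 'm \<times> 'a)) set|"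
    by (rule inj_UNIV_ordLeq)
  also have "|UNIV :: (('o \<times> 'a \<times> 'a) + ('o \<times> 'o \<times> 'm \<times> 'a)) set| \<le>o |UNIV :: 'k set|"
    by (intro sum_ordLeq_infinite prod_ordLeq_infinite assms)
  finally show ?thesis .
qed

lemma cmodule_ordLeq:
  assumes inf: "infinite (UNIV :: 'k set)"
    and o: "|UNIV :: 'o set| \<le>o |UNIV :: 'k set|" and m: "|UNIV :: 'm set| \<le>o |UNIV :: 'k set|"
    and a: "|UNIV :: 'a set| \<le>o |UNIV :: 'k set|"
  shows "|UNIV :: ('o, 'm, 'a) cmodule set| \<le>o |UNIV :: 'k set set|"
proof -
  define h :: "('o, 'm, 'a) cmodule \<Rightarrow> ('o \<Rightarrow> 'a set) \<times> ('o \<Rightarrow> 'a \<Rightarrow> 'a \<Rightarrow> 'a) \<times> ('o \<Rightarrow> 'a)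
      \<times> ('o \<Rightarrow> 'o \<Rightarrow> 'm \<Rightarrow> 'a \<Rightarrow> 'a)" where
    "h A = (\<lambda>a. carrier (grp A a), \<lambda>a. monoid.mult (grp A a), \<lambda>a. one (grp A a), act A)" for A
  have "inj h"
  proof (rule injI)
    fix A A' :: "('o, 'm, 'a) cmodule" assume eq: "h A = h A'"
    then have "grp A a = grp A' a" for a by (simp add: h_def fun_eq_iff)
    with eq show "A = A'" by (simp add: h_def fun_eq_iff)
  qed
  then have "|UNIV :: ('o, 'm, 'a) cmodule set| \<le>o |UNIV :: (('o \<Rightarrow> 'a set) \<times> ('o \<Rightarrow> 'a \<Rightarrow> 'a \<Rightarrow> 'a)
      \<times> ('o \<Rightarrow> 'a) \<times> ('o \<Rightarrow> 'o \<Rightarrow> 'm \<Rightarrow> 'a \<Rightarrow> 'a)) set|"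
    by (rule inj_UNIV_ordLeq)
  also have "|UNIV :: (('o \<Rightarrow> 'a set) \<times> ('o \<Rightarrow> 'a \<Rightarrow> 'a \<Rightarrow> 'a)
      \<times> ('o \<Rightarrow> 'a) \<times> ('o \<Rightarrow> 'o \<Rightarrow> 'm \<Rightarrow> 'a \<Rightarrow> 'a)) set| \<le>o |UNIV :: 'k set set|"
    by (intro prod_ordLeq_infinite fun_ordLeq_set set_ordLeq_set ordLeq_set[OF a] infinite_set inf o m a)
  finally show ?thesis .
qed

text \<open>
  The module operations are added to the given operations. The closure may leave the elements of
  \<open>M\<close> through values of \<open>op\<close> outside it and is cut down to \<open>M\<close> afterwards; hence closure is asserted
  for values in \<open>M\<close>.
\<close>

lemma small_closed_submodule:
  fixes M :: "('o, 'm, 'u) cmodule" and op :: "'t \<Rightarrow> ('i \<Rightarrow> 'o \<times> 'u) \<Rightarrow> 'o \<times> 'u"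
  assumes M: "is_module \<C> M" and inf: "infinite (UNIV :: 'k set)"
    and o: "|UNIV :: 'o set| \<le>o |UNIV :: 'k set|" and m: "|UNIV :: 'm set| \<le>o |UNIV :: 'k set|"
    and i: "|UNIV :: 'i set| \<le>o |UNIV :: 'k set|" and t: "|UNIV :: 't set| \<le>o |UNIV :: 'k set set|"
    and x0: "x0 \<in> Sigma (Obj \<C>) (carr M)"
  obtains N where "submodule \<C> N M" and "|Sigma (Obj \<C>) N| \<le>o |UNIV :: 'k set set|"
    and "x0 \<in> Sigma (Obj \<C>) N"
    and "\<And>t e. range e \<subseteq> Sigma (Obj \<C>) N \<Longrightarrow> op t e \<in> Sigma (Obj \<C>) (carr M)
      \<Longrightarrow> op t e \<in> Sigma (Obj \<C>) N"
proof -
  define op' :: "('o, 'm, 't) module_op \<Rightarrow> (nat + 'i \<Rightarrow> 'o \<times> 'u) \<Rightarrow> 'o \<times> 'u" where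
    "op' t e = (let (b, x) = e (Inl 0); (c, y) = e (Inl 1) in case t of
        Zero a \<Rightarrow> (a, \<one>\<^bsub>grp M a\<^esub>)
      | Diff \<Rightarrow> (b, diff M b x y)
      | Act a f \<Rightarrow> (a, act M a b f x)
      | Extra t \<Rightarrow> op t (\<lambda>i. e (Inr i)))" for t e
  obtain C where small: "|C| \<le>o |UNIV :: 'k set set|" and C0: "x0 \<in> C"
    and C: "\<And>t e. range e \<subseteq> C \<Longrightarrow> op' t e \<in> C"
  proof (rule small_closed_set[OF inf, of x0 op'])
    show "|UNIV :: (nat + 'i) set| \<le>o |UNIV :: 'k set|"
      by (intro sum_ordLeq_infinite nat_ordLeq_infinite inf i)
    show "|UNIV :: ('o, 'm, 't) module_op set| \<le>o |UNIV :: 'k set set|"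
      by (intro module_op_ordLeq infinite_set inf ordLeq_set o m t)
  qed blast
  define N where "N a = {x \<in> carrier (grp M a). (a, x) \<in> C}" for a
  have N: "(a, x) \<in> C" "x \<in> carrier (grp M a)" if "x \<in> N a" for a x
    using that by (simp_all add: N_def)
  have zero: "\<one>\<^bsub>grp M a\<^esub> \<in> N a" if a: "a \<in> Obj \<C>" for a
  proof -
    interpret comm_group "grp M a" by (rule module_group[OF M a])
    show ?thesis using C[of "\<lambda>_. x0" "Zero a"] C0 by (simp add: N_def op'_def split: prod.splits)
  qed
  have dif: "diff M a x y \<in> N a" if a: "a \<in> Obj \<C>" and x: "x \<in> N a" and y: "y \<in> N a" for a x y
  proof -
    interpret comm_group "grp M a" by (rule module_group[OF M a])
    show ?thesis using C[of "\<lambda>i. if i = Inl 0 then (a, x) else (a, y)" Diff] N[OF x] N[OF y]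
      by (auto simp add: N_def op'_def)
  qed
  have act: "act M a b f x \<in> N a" if ab: "a \<in> Obj \<C>" "b \<in> Obj \<C>" "f \<in> Mor \<C> a b" and x: "x \<in> N b" for a b f x
    using C[of "\<lambda>i. (b, x)" "Act a f"] N[OF x] act_closed[OF M ab] by (simp add: N_def op'_def)
  have sub: "submodule \<C> N M"
    unfolding submodule_def
  proof (intro conjI ballI)
    fix a assume a: "a \<in> Obj \<C>"
    interpret comm_group "grp M a" by (rule module_group[OF M a])
    have inv: "inv\<^bsub>grp M a\<^esub> x \<in> N a" if "x \<in> N a" for x
      using dif[OF a zero[OF a] that] N(2)[OF that] by simp
    show "subgroup (N a) (grp M a)"
    proof (rule subgroupI)
      show "N a \<subseteq> carrier (grp M a)" by (auto simp: N_def)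
      show "N a \<noteq> {}" using zero[OF a] by blast
      show "inv\<^bsub>grp M a\<^esub> x \<in> N a" if "x \<in> N a" for x by (rule inv[OF that])
      show "x \<otimes>\<^bsub>grp M a\<^esub> y \<in> N a" if "x \<in> N a" "y \<in> N a" for x y
        using dif[OF a that(1) inv[OF that(2)]] N(2)[OF that(2)] by simp
    qed
  next
    fix a b f assume "a \<in> Obj \<C>" "b \<in> Obj \<C>" "f \<in> Mor \<C> a b"
    then show "act M a b f ` N b \<subseteq> N a" using act by blast
  qed
  have SigmaN: "Sigma (Obj \<C>) N = C \<inter> Sigma (Obj \<C>) (carr M)" by (auto simp: N_def)
  show thesis
  proof (rule that[OF sub])
    show "|Sigma (Obj \<C>) N| \<le>o |UNIV :: 'k set set|"
      unfolding SigmaN using card_of_mono1[OF Int_lower1] small by (rule ordLeq_transitive)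
    show "x0 \<in> Sigma (Obj \<C>) N" using C0 x0 by (simp add: SigmaN)
    fix t e assume e: "range e \<subseteq> Sigma (Obj \<C>) N" and "op t e \<in> Sigma (Obj \<C>) (carr M)"
    moreover have "op t e \<in> C"
    proof -
      have "range (\<lambda>i. case i of Inl _ \<Rightarrow> x0 | Inr i \<Rightarrow> e i) \<subseteq> C"
        using e C0 by (simp add: SigmaN image_subset_iff split: sum.splits)
      from C[OF this, of "Extra t"] show ?thesis by (simp add: op'_def split: prod.splits)
    qed
    ultimately show "op t e \<in> Sigma (Obj \<C>) N" by (simp add: SigmaN)
  qed
qed

text \<open>
  For each \<open>A\<close> and each attainable prescription of defects one family that attains it is chosen, and
  its values are added. A prescription has one entry per law, so these operations have at most \<open>'k\<close>
  arguments. They are labelled by \<open>A\<close> and an element of \<open>A\<close>; there are at most \<open>2\<^sup>k\<close> labels because the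
  type of all modules on \<open>'o\<close>, \<open>'m\<close>, \<open>'a\<close> is no larger than that.
\<close>

lemma small_pure_modulo:
  fixes M :: "('o, 'm, 'u) cmodule" and \<A> :: "('o, 'm, 'a) cmodule set"
  assumes M: "is_module \<C> M"
    and inf: "infinite (UNIV :: 'k set)"
    and o: "|UNIV :: 'o set| \<le>o |UNIV :: 'k set|" and m: "|UNIV :: 'm set| \<le>o |UNIV :: 'k set|"
    and a: "|UNIV :: 'a set| \<le>o |UNIV :: 'k set|"
    and x: "c \<in> Obj \<C>" "x \<in> carrier (grp M c)"
  obtains Q where "submodule \<C> Q M" and "|Sigma (Obj \<C>) Q| \<le>o |UNIV :: 'k set set|"
    and "x \<in> Q c" and "pure_modulo \<C> \<A> B Q M"
proof -
  define sol where "sol A e s \<longleftrightarrow> family_in \<C> A (carr M) s \<and>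
    (\<forall>l\<in>laws \<C> A. diff M (law_obj l) (defect A M s l) (snd (e l)) \<in> B (law_obj l))"
    for A :: "('o, 'm, 'a) cmodule" and e :: "('o, 'm, 'a) law \<Rightarrow> 'o \<times> 'u" and s
  define op :: "('o, 'm, 'a) cmodule \<times> 'o \<times> 'a \<Rightarrow> (('o, 'm, 'a) law \<Rightarrow> 'o \<times> 'u) \<Rightarrow> 'o \<times> 'u"
    where "op = (\<lambda>(A, a, y) e. (a, (SOME s. sol A e s) a y))"
  obtain Q where Q: "submodule \<C> Q M" and small: "|Sigma (Obj \<C>) Q| \<le>o |UNIV :: 'k set set|"
    and x0: "(c, x) \<in> Sigma (Obj \<C>) Q"
    and op: "\<And>t e. range e \<subseteq> Sigma (Obj \<C>) Q \<Longrightarrow> op t e \<in> Sigma (Obj \<C>) (carr M)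
      \<Longrightarrow> op t e \<in> Sigma (Obj \<C>) Q"
  proof (rule small_closed_submodule[OF M inf o m, of "(c, x)" op])
    show "|UNIV :: ('o, 'm, 'a) law set| \<le>o |UNIV :: 'k set|"
      by (rule law_ordLeq[OF inf o m a])
    show "|UNIV :: (('o, 'm, 'a) cmodule \<times> 'o \<times> 'a) set| \<le>o |UNIV :: 'k set set|"
      by (intro prod_ordLeq_infinite infinite_set inf cmodule_ordLeq ordLeq_set o m a)
  qed (use x in auto)
  have "pure_modulo \<C> \<A> B Q M"
    unfolding pure_modulo_def
  proof (intro ballI allI impI, elim conjE)
    fix A :: "('o, 'm, 'a) cmodule" and s d
    assume s: "family_in \<C> A (carr M) s"
      and d: "\<forall>l\<in>laws \<C> A. d l \<in> Q (law_obj l) \<and> diff M (law_obj l) (defect A M s l) (d l) \<in> B (law_obj l)"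
    define e where "e l = (if l \<in> laws \<C> A then (law_obj l, d l) else (c, x))" for l
    have e: "range e \<subseteq> Sigma (Obj \<C>) Q" using d x0 by (auto simp: e_def law_obj_Obj)
    have "sol A e s" using s d by (simp add: sol_def e_def)
    define p where "p = (SOME p. sol A e p)"
    have p: "sol A e p" unfolding p_def by (rule someI[of "sol A e"]) fact
    have "family_in \<C> A Q p"
      unfolding family_in_def
    proof (intro ballI)
      fix a y assume ay: "a \<in> Obj \<C>" "y \<in> carrier (grp A a)"
      have "op (A, a, y) e = (a, p a y)" by (simp add: op_def p_def)
      moreover have "p a y \<in> carrier (grp M a)" using p ay by (simp add: sol_def family_in_def)
      ultimately show "p a y \<in> Q a" using op[OF e, of "(A, a, y)"] ay by simp
    qed
    then show "\<exists>p. family_in \<C> A Q p \<and>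
           (\<forall>l\<in>laws \<C> A. diff M (law_obj l) (defect A M p l) (d l) \<in> B (law_obj l))"
      using p by (auto simp: sol_def e_def)
  qed
  then show thesis using that Q small x0 by blast
qed

text \<open>
  The colouring \<open>cls\<close> is meant to separate the cosets of some submodule; an element and its copy then
  differ by an element of that submodule.
\<close>

definition copies_into ::
  "('o, 'm) additive_cat \<Rightarrow> ('o, 'm, 'u) cmodule \<Rightarrow> ('o \<times> 'u \<Rightarrow> 'l) \<Rightarrow> ('o \<Rightarrow> 'u set) \<Rightarrow> ('o \<Rightarrow> 'u set)
     \<Rightarrow> ('o \<Rightarrow> 'u \<Rightarrow> 'u) \<Rightarrow> bool" where
  "copies_into \<C> M cls Q B \<phi> \<longleftrightarrow>
     (\<forall>a\<in>Obj \<C>. \<forall>x\<in>Q a. \<phi> a x \<in> B a \<and> cls (a, \<phi> a x) = cls (a, x) \<and> (x \<in> B a \<longrightarrow> \<phi> a x = x)) \<and>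
     (\<forall>a\<in>Obj \<C>. \<forall>x\<in>Q a. \<forall>y\<in>Q a. \<phi> a (x \<otimes>\<^bsub>grp M a\<^esub> y) = \<phi> a x \<otimes>\<^bsub>grp M a\<^esub> \<phi> a y) \<and>
     (\<forall>a\<in>Obj \<C>. \<forall>b\<in>Obj \<C>. \<forall>f\<in>Mor \<C> a b. \<forall>x\<in>Q b. \<phi> a (act M a b f x) = act M a b f (\<phi> b x))"

text \<open>
  A downward Loewenheim-Skolem argument. An enumeration \<open>e\<close> of \<open>Q\<close> by \<open>'w\<close> is described by its diagram:
  objects, colours, and the relations that say which entries are sums or images of others. The
  operations take the entries that already are in \<open>B\<close> and return the entries of some enumeration
  that has the same diagram and extends the given entries; one exists, as \<open>e\<close> shows. Closure of \<open>B\<close>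
  under these operations makes the new enumeration run in \<open>B\<close>, and matching the entries of the two
  enumerations yields the homomorphism. There are only \<open>2\<^sup>w\<close> diagrams.
\<close>

lemma small_reflecting_submodule:
  fixes M :: "('o, 'm, 'u) cmodule" and cls :: "'o \<times> 'u \<Rightarrow> 'l"
  assumes M: "is_module \<C> M"
    and inf: "infinite (UNIV :: 'w set)"
    and o: "|UNIV :: 'o set| \<le>o |UNIV :: 'w set|" and m: "|UNIV :: 'm set| \<le>o |UNIV :: 'w set|"
    and l: "|UNIV :: 'l set| \<le>o |UNIV :: 'w set|"
    and ne: "x0 \<in> Sigma (Obj \<C>) (carr M)"
  obtains B where "submodule \<C> B M" and "|Sigma (Obj \<C>) B| \<le>o |UNIV :: 'w set set|"
    and "\<And>Q. submodule \<C> Q M \<Longrightarrow> |Sigma (Obj \<C>) Q| \<le>o |UNIV :: 'w set| \<Longrightarrow>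
      \<exists>\<phi>. copies_into \<C> M cls Q B \<phi>"
proof -
  define diagram :: "('w \<Rightarrow> 'o \<times> 'u) \<Rightarrow> ('w \<Rightarrow> 'o \<times> 'l) \<times> ('w \<times> 'w \<times> 'w) set \<times> ('m \<times> 'w \<times> 'w) set"
    where "diagram e = (\<lambda>i. (fst (e i), cls (e i)),
      {(i, j, k). fst (e i) = fst (e k) \<and> fst (e j) = fst (e k) \<and> snd (e k) = snd (e i) \<otimes>\<^bsub>grp M (fst (e k))\<^esub> snd (e j)},
      {(f, i, j). f \<in> Mor \<C> (fst (e j)) (fst (e i)) \<and> snd (e j) = act M (fst (e j)) (fst (e i)) f (snd (e i))})" for e
  define copy where "copy U D e e' \<longleftrightarrow> range e' \<subseteq> Sigma (Obj \<C>) (carr M) \<and> (\<forall>i\<in>U. e' i = e i) \<and> diagram e' = D"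
    for U D and e e' :: "'w \<Rightarrow> 'o \<times> 'u"
  define op :: "'w set \<times> (('w \<Rightarrow> 'o \<times> 'l) \<times> ('w \<times> 'w \<times> 'w) set \<times> ('m \<times> 'w \<times> 'w) set) \<times> 'w \<Rightarrow> ('w \<Rightarrow> 'o \<times> 'u) \<Rightarrow> 'o \<times> 'u"
    where "op = (\<lambda>(U, D, i) e. (SOME e'. copy U D e e') i)"
  obtain B where B: "submodule \<C> B M" and small: "|Sigma (Obj \<C>) B| \<le>o |UNIV :: 'w set set|"
    and x0: "x0 \<in> Sigma (Obj \<C>) B"
    and op: "\<And>t e. range e \<subseteq> Sigma (Obj \<C>) B \<Longrightarrow> op t e \<in> Sigma (Obj \<C>) (carr M)
      \<Longrightarrow> op t e \<in> Sigma (Obj \<C>) B"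
  proof (rule small_closed_submodule[OF M inf o m, of x0 op])
    have w: "|UNIV :: 'w set| \<le>o |UNIV :: 'w set|" by (rule ordLeq_reflexive[OF card_of_Well_order])
    then show "|UNIV :: 'w set| \<le>o |UNIV :: 'w set|" .
    show "|UNIV :: ('w set \<times> (('w \<Rightarrow> 'o \<times> 'l) \<times> ('w \<times> 'w \<times> 'w) set \<times> ('m \<times> 'w \<times> 'w) set) \<times> 'w) set|
        \<le>o |UNIV :: 'w set set|"
      by (intro prod_ordLeq_infinite[OF infinite_set[OF inf]] fun_ordLeq_set set_ordLeq_set prod_ordLeq_infinite[OF inf] ordLeq_set[OF o]
          ordLeq_set[OF l] ordLeq_set[OF w] inf w m o l)
  qed (use ne in auto)
  show thesis
  proof (rule that[OF B small])
    fix Q assume Q: "submodule \<C> Q M" and Qs: "|Sigma (Obj \<C>) Q| \<le>o |UNIV :: 'w set|"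
    let ?Q = "Sigma (Obj \<C>) Q"
    have "(fst x0, \<one>\<^bsub>grp M (fst x0)\<^esub>) \<in> ?Q" using ne submodule_one[OF Q] by auto
    then have "?Q \<noteq> {}" by blast
    then obtain e :: "'w \<Rightarrow> 'o \<times> 'u" where e: "range e = ?Q"
      using card_of_ordLeq2[of ?Q "UNIV :: 'w set"] Qs by auto
    define U where "U = {i. e i \<in> Sigma (Obj \<C>) B}"
    \<comment> \<open>The operations see only the entries in B; the others are hidden behind an element of B.\<close>
    define e0 where "e0 i = (if i \<in> U then e i else x0)" for i
    have e0: "range e0 \<subseteq> Sigma (Obj \<C>) B" using x0 by (auto simp: e0_def U_def)
    have QM: "?Q \<subseteq> Sigma (Obj \<C>) (carr M)" using submodule_mem[OF Q] by auto
    define e' where "e' = (SOME e'. copy U (diagram e) e0 e')"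
    have "copy U (diagram e) e0 e" using e QM by (simp add: copy_def e0_def)
    then have e': "copy U (diagram e) e0 e'" unfolding e'_def by (rule someI[of "copy U (diagram e) e0"])
    have e'B: "e' i \<in> Sigma (Obj \<C>) B" for i
    proof -
      have "op (U, diagram e, i) e0 = e' i" by (simp add: op_def e'_def)
      moreover have "e' i \<in> Sigma (Obj \<C>) (carr M)" using e' unfolding copy_def by blast
      ultimately show ?thesis using op[OF e0, of "(U, diagram e, i)"] by simp
    qed
    have D: "diagram e' = diagram e" using e' by (simp add: copy_def)
    have fst': "fst (e' i) = fst (e i)" and cls': "cls (e' i) = cls (e i)" for i
      using arg_cong[OF D, of fst, THEN fun_cong, of i] by (simp_all add: diagram_def)
    have mult': "snd (e' k) = snd (e' i) \<otimes>\<^bsub>grp M (fst (e k))\<^esub> snd (e' j)"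
      if "fst (e i) = fst (e k)" "fst (e j) = fst (e k)" "snd (e k) = snd (e i) \<otimes>\<^bsub>grp M (fst (e k))\<^esub> snd (e j)" for i j k
    proof -
      have "(i, j, k) \<in> fst (snd (diagram e'))" unfolding D using that by (simp add: diagram_def)
      then show ?thesis by (simp add: diagram_def fst')
    qed
    have act': "snd (e' j) = act M (fst (e j)) (fst (e i)) f (snd (e' i))"
      if "f \<in> Mor \<C> (fst (e j)) (fst (e i))" "snd (e j) = act M (fst (e j)) (fst (e i)) f (snd (e i))" for f i j
    proof -
      have "(f, i, j) \<in> snd (snd (diagram e'))" unfolding D using that by (simp add: diagram_def)
      then show ?thesis by (simp add: diagram_def fst')
    qed
    define ix where "ix a x = inv_into UNIV e (a, x)" for a x
    have ix: "e (ix a x) = (a, x)" if "a \<in> Obj \<C>" "x \<in> Q a" for a x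
      using e that unfolding ix_def by (intro f_inv_into_f) auto
    define \<phi> where "\<phi> a x = snd (e' (ix a x))" for a x
    have pair: "e' (ix a x) = (a, \<phi> a x)" if "a \<in> Obj \<C>" "x \<in> Q a" for a x
      using fst'[of "ix a x"] ix[OF that] by (simp add: \<phi>_def prod_eq_iff)
    have "copies_into \<C> M cls Q B \<phi>"
      unfolding copies_into_def
    proof (intro conjI ballI impI)
      fix a x assume ax: "a \<in> Obj \<C>" "x \<in> Q a"
      show "\<phi> a x \<in> B a" using e'B[of "ix a x"] pair[OF ax] by simp
      show "cls (a, \<phi> a x) = cls (a, x)" using cls'[of "ix a x"] pair[OF ax] ix[OF ax] by simp
      show "\<phi> a x = x" if "x \<in> B a"
      proof -
        have "ix a x \<in> U" using that ix[OF ax] ax by (simp add: U_def)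
        then show ?thesis using e' pair[OF ax] ix[OF ax] by (auto simp: copy_def e0_def)
      qed
      fix y assume y: "y \<in> Q a"
      have xy: "x \<otimes>\<^bsub>grp M a\<^esub> y \<in> Q a" by (rule submodule_mult[OF Q ax y])
      show "\<phi> a (x \<otimes>\<^bsub>grp M a\<^esub> y) = \<phi> a x \<otimes>\<^bsub>grp M a\<^esub> \<phi> a y"
        using mult'[of "ix a x" "ix a (x \<otimes>\<^bsub>grp M a\<^esub> y)" "ix a y"] ix[OF ax] ix[OF ax(1) y] ix[OF ax(1) xy]
        by (simp add: \<phi>_def)
    next
      fix a b f x assume ab: "a \<in> Obj \<C>" "b \<in> Obj \<C>" "f \<in> Mor \<C> a b" and x: "x \<in> Q b"
      have fx: "act M a b f x \<in> Q a" by (rule submodule_act[OF Q ab x])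
      show "\<phi> a (act M a b f x) = act M a b f (\<phi> b x)"
        using act'[of f "ix a (act M a b f x)" "ix b x"] ix[OF ab(2) x] ix[OF ab(1) fx] ab(3)
        by (simp add: \<phi>_def)
    qed
    then show "\<exists>\<phi>. copies_into \<C> M cls Q B \<phi>" by (intro exI)
  qed
qed

section \<open>Non-trivial pure submodules\<close>

text \<open>
  The cardinality of \<open>M/L\<close> only counts elements over the skeleton. Over any other object, cosets are
  transported along an isomorphism to an object of the skeleton and coloured there.
\<close>

lemma quotient_colouring:
  assumes C: "category \<C>" and S: "skeleton \<C> S" and M: "is_module \<C> M" and L: "submodule \<C> L M"
    and lam: "Card_order (lam :: 'l rel)" and small: "module_card S (quotient_module M L) \<le>o lam"
  obtains cls :: "'o \<times> 'u \<Rightarrow> 'l" where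
    "\<And>a x y. a \<in> Obj \<C> \<Longrightarrow> x \<in> carrier (grp M a) \<Longrightarrow> y \<in> carrier (grp M a)
      \<Longrightarrow> cls (a, x) = cls (a, y) \<Longrightarrow> diff M a x y \<in> L a"
proof -
  have "|SIGMA a:S. carrier (grp (quotient_module M L) a)| \<le>o |Field lam|"
    using small card_of_Field_ordIso[OF lam] unfolding module_card_def
    by (meson ordIso_symmetric ordLeq_ordIso_trans)
  then obtain h :: "'o \<times> 'u set \<Rightarrow> 'l" where h: "inj_on h (SIGMA a:S. carrier (grp (quotient_module M L) a))"
    unfolding card_of_ordLeq[symmetric] by (elim exE conjE) (rule that)
  have "\<forall>a\<in>Obj \<C>. \<exists>s f g. s \<in> S \<and> s \<in> Obj \<C> \<and> f \<in> Mor \<C> a s \<and> g \<in> Mor \<C> s a \<and> Comp \<C> a s a g f = Idt \<C> a"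
  proof
    fix a assume "a \<in> Obj \<C>"
    then obtain s where "s \<in> S" "iso_objects \<C> a s" using S by (auto simp: skeleton_def)
    then show "\<exists>s f g. s \<in> S \<and> s \<in> Obj \<C> \<and> f \<in> Mor \<C> a s \<and> g \<in> Mor \<C> s a \<and> Comp \<C> a s a g f = Idt \<C> a"
      using S by (auto simp: skeleton_def iso_objects_def)
  qed
  then obtain s f g where s: "\<And>a. a \<in> Obj \<C> \<Longrightarrow> s a \<in> S" "\<And>a. a \<in> Obj \<C> \<Longrightarrow> s a \<in> Obj \<C>"
    and f: "\<And>a. a \<in> Obj \<C> \<Longrightarrow> f a \<in> Mor \<C> a (s a)" and g: "\<And>a. a \<in> Obj \<C> \<Longrightarrow> g a \<in> Mor \<C> (s a) a"
    and gf: "\<And>a. a \<in> Obj \<C> \<Longrightarrow> Comp \<C> a (s a) a (g a) (f a) = Idt \<C> a"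
    by metis
  define cls where "cls = (\<lambda>(a, x). h (s a, L (s a) #>\<^bsub>grp M (s a)\<^esub> act M (s a) a (g a) x))"
  have "diff M a x y \<in> L a"
    if a: "a \<in> Obj \<C>" and x: "x \<in> carrier (grp M a)" and y: "y \<in> carrier (grp M a)" and eq: "cls (a, x) = cls (a, y)"
    for a x y
  proof -
    interpret comm_group "grp M a" by (rule module_group[OF M a])
    note sa = s(2)[OF a] and ga = g[OF a] and fa = f[OF a]
    note gx = act_closed[OF M sa a ga x] and gy = act_closed[OF M sa a ga y]
    have xy: "diff M a x y \<in> carrier (grp M a)" using x y by simp
    have "L (s a) #>\<^bsub>grp M (s a)\<^esub> act M (s a) a (g a) x = L (s a) #>\<^bsub>grp M (s a)\<^esub> act M (s a) a (g a) y"
      using inj_onD[OF h eq[unfolded cls_def prod.case]] s(1)[OF a] gx gy by (simp add: carrier_quotient)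
    then have "diff M (s a) (act M (s a) a (g a) x) (act M (s a) a (g a) y) \<in> L (s a)"
      using rcoset_eq_iff[OF module_group[OF M sa] submodule_subgroup[OF L sa] gx gy] by blast
    then have "act M (s a) a (g a) (diff M a x y) \<in> L (s a)"
      using x y by (simp add: act_mult[OF M sa a ga] act_inv[OF M sa a ga])
    then have "act M a (s a) (f a) (act M (s a) a (g a) (diff M a x y)) \<in> L a"
      by (rule submodule_act[OF L a sa fa])
    moreover have "act M a (s a) (f a) (act M (s a) a (g a) (diff M a x y)) = act M a a (Comp \<C> a (s a) a (g a) (f a)) (diff M a x y)"
      using M a sa fa ga xy unfolding is_module_def by simp
    moreover have "\<dots> = diff M a x y"
      using M a xy by (simp add: gf[OF a] is_module_def)
    ultimately show ?thesis by simp
  qed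
  then show thesis by (rule that)
qed

text \<open>
  The submodule of all \<open>x - \<phi>(x)\<close> has the same image in \<open>M/B\<close> as \<open>Q\<close>, since \<open>\<phi>\<close> takes values in \<open>B\<close>. It
  meets \<open>B\<close> trivially: if \<open>x - \<phi>(x)\<close> is in \<open>B\<close> then so is \<open>x\<close>, whence \<open>\<phi>(x) = x\<close>.
\<close>

lemma pure_difference_submodule:
  assumes C: "preadditive_category \<C>" and M: "is_module \<C> M" and mods: "\<forall>A\<in>\<A>. is_module \<C> A"
    and B: "submodule \<C> B M" and Q: "submodule \<C> Q M" and pure: "pure_modulo \<C> \<A> B Q M"
    and \<phi>: "copies_into \<C> M cls Q B \<phi>"
  shows "pure_submodule \<C> \<A> (\<lambda>a. (\<lambda>x. diff M a x (\<phi> a x)) ` Q a) M"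
proof -
  let ?D = "\<lambda>a. (\<lambda>x. diff M a x (\<phi> a x)) ` Q a"
  have \<phi>B: "\<phi> a x \<in> B a" and fixB: "x \<in> B a \<Longrightarrow> \<phi> a x = x" if "a \<in> Obj \<C>" "x \<in> Q a" for a x
    using \<phi> that by (simp_all add: copies_into_def)
  have add: "\<phi> a (x \<otimes>\<^bsub>grp M a\<^esub> y) = \<phi> a x \<otimes>\<^bsub>grp M a\<^esub> \<phi> a y"
    if "a \<in> Obj \<C>" "x \<in> Q a" "y \<in> Q a" for a x y
    using \<phi> that by (simp add: copies_into_def)
  have nat: "\<phi> a (act M a b f x) = act M a b f (\<phi> b x)"
    if "a \<in> Obj \<C>" "b \<in> Obj \<C>" "f \<in> Mor \<C> a b" "x \<in> Q b" for a b f x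
    using \<phi> that by (simp add: copies_into_def)
  note Qc = submodule_mem[OF Q] and \<phi>c = submodule_mem[OF B _ \<phi>B]
  have D: "submodule \<C> ?D M"
    unfolding submodule_def
  proof (intro conjI ballI subsetI)
    fix a assume a: "a \<in> Obj \<C>"
    interpret comm_group "grp M a" by (rule module_group[OF M a])
    note [simp] = Qc[OF a] \<phi>c[OF a a]
    \<comment> \<open>One lies in both Q and B, where the map is the identity.\<close>
    have phi1: "\<phi> a \<one>\<^bsub>grp M a\<^esub> = \<one>\<^bsub>grp M a\<^esub>"
      by (rule fixB[OF a submodule_one[OF Q a] submodule_one[OF B a]])
    show "subgroup (?D a) (grp M a)"
    proof (rule subgroupI)
      show "?D a \<subseteq> carrier (grp M a)" by auto
      show "?D a \<noteq> {}" using submodule_one[OF Q a] by blast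
      show "inv\<^bsub>grp M a\<^esub> d \<in> ?D a" if "d \<in> ?D a" for d
      proof -
        obtain x where x: "x \<in> Q a" and d: "d = diff M a x (\<phi> a x)" using \<open>d \<in> ?D a\<close> by blast
        have ix: "inv\<^bsub>grp M a\<^esub> x \<in> Q a" by (rule submodule_inv[OF Q a x])
        have "\<phi> a (inv\<^bsub>grp M a\<^esub> x) \<otimes>\<^bsub>grp M a\<^esub> \<phi> a x = \<one>\<^bsub>grp M a\<^esub>"
          using add[OF a ix x] x phi1 by simp
        then have "\<phi> a (inv\<^bsub>grp M a\<^esub> x) = inv\<^bsub>grp M a\<^esub> (\<phi> a x)"
          using inv_equality \<phi>c[OF a a x] \<phi>c[OF a a ix] by metis
        then have "inv\<^bsub>grp M a\<^esub> d = diff M a (inv\<^bsub>grp M a\<^esub> x) (\<phi> a (inv\<^bsub>grp M a\<^esub> x))"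
          using x a by (simp add: d inv_mult)
        then show ?thesis using ix by blast
      qed
      show "d \<otimes>\<^bsub>grp M a\<^esub> e \<in> ?D a" if de: "d \<in> ?D a" "e \<in> ?D a" for d e
      proof -
        obtain x y where x: "x \<in> Q a" "d = diff M a x (\<phi> a x)" and y: "y \<in> Q a" "e = diff M a y (\<phi> a y)"
          using de by blast
        have "d \<otimes>\<^bsub>grp M a\<^esub> e = diff M a (x \<otimes>\<^bsub>grp M a\<^esub> y) (\<phi> a (x \<otimes>\<^bsub>grp M a\<^esub> y))"
          using x y a by (simp add: add[OF a x(1) y(1)] inv_mult m_ac)
        then show ?thesis using submodule_mult[OF Q a x(1) y(1)] by blast
      qed
    qed
  next
    fix a b f d assume ab: "a \<in> Obj \<C>" "b \<in> Obj \<C>" "f \<in> Mor \<C> a b" and "d \<in> act M a b f ` ?D b"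
    then obtain x where x: "x \<in> Q b" and d: "d = act M a b f (diff M b x (\<phi> b x))" by blast
    interpret comm_group "grp M b" by (rule module_group[OF M ab(2)])
    have "d = diff M a (act M a b f x) (\<phi> a (act M a b f x))"
      using Qc[OF ab(2) x] \<phi>c[OF ab(2) ab(2) x]
      by (simp add: d act_mult[OF M ab] act_inv[OF M ab] nat[OF ab x])
    then show "d \<in> ?D a" using submodule_act[OF Q ab x] by blast
  qed
  have absorb: "diff M a x (diff M a x (\<phi> a x)) \<in> B a" if a: "a \<in> Obj \<C>" and x: "x \<in> Q a" for a x
  proof -
    interpret comm_group "grp M a" by (rule module_group[OF M a])
    have "diff M a x (diff M a x (\<phi> a x)) = \<phi> a x"
      using Qc[OF a x] \<phi>c[OF a a x] by (simp add: inv_mult m_assoc[symmetric])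
    then show ?thesis using \<phi>B[OF a x] by simp
  qed
  show ?thesis
  proof (rule pure_submodule_if_pure_modulo[OF C M mods B D])
    show "pure_modulo \<C> \<A> B ?D M"
      by (rule pure_modulo_transfer[OF M mods B Q D _ _ pure]) (use absorb in blast)+
    fix a d assume a: "a \<in> Obj \<C>" and "d \<in> ?D a" and dB: "d \<in> B a"
    then obtain x where x: "x \<in> Q a" and d: "d = diff M a x (\<phi> a x)" by blast
    interpret comm_group "grp M a" by (rule module_group[OF M a])
    have "x = d \<otimes>\<^bsub>grp M a\<^esub> \<phi> a x" using Qc[OF a x] \<phi>c[OF a a x] by (simp add: d m_assoc)
    then have "x \<in> B a" using submodule_mult[OF B a dB \<phi>B[OF a x]] by simp
    then show "d = \<one>\<^bsub>grp M a\<^esub>" using fixB[OF a x] Qc[OF a x] by (simp add: d)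
  qed
qed

theorem theorem4p2:
  fixes \<C> :: "('o, 'm) additive_cat"
    and S :: "'o set"
    and \<A> :: "('o, 'm, 'a) cmodule set"
    and lam :: "'l rel"
  assumes "additive_category \<C>"
    and "skeleton \<C> S"
    and "\<forall>A\<in>\<A>. is_module \<C> A"
    and "Card_order lam"
  shows "\<exists>\<kappa> :: ('o, 'm, 'a, 'l) bound rel. Card_order \<kappa> \<and>
    (\<forall>(M :: ('o, 'm, 'u) cmodule) L.
       is_module \<C> M \<and> submodule \<C> L M \<and>
       \<kappa> \<le>o module_card S M \<and> module_card S (quotient_module M L) \<le>o lam \<longrightarrow>
       (\<exists>P. (\<forall>a\<in>Obj \<C>. P a \<subseteq> L a) \<and> pure_submodule \<C> \<A> P M \<and> nonzero_sub \<C> P M))"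
proof (intro exI[of _ "|UNIV :: ('o, 'm, 'a, 'l) bound set|"] conjI allI impI, rule card_of_Card_order, elim conjE)
  fix M :: "('o, 'm, 'u) cmodule" and L
  assume M: "is_module \<C> M" and L: "submodule \<C> L M"
    and big: "|UNIV :: ('o, 'm, 'a, 'l) bound set| \<le>o module_card S M"
    and small: "module_card S (quotient_module M L) \<le>o lam"
  have C: "preadditive_category \<C>" and cat: "category \<C>"
    using assms(1) by (simp_all add: additive_category_def preadditive_category_def)
  have SC: "S \<subseteq> Obj \<C>" using assms(2) by (simp add: skeleton_def)
  have inf: "infinite (UNIV :: (nat + 'o + 'm + 'a + 'l) set)" by simp
  have o: "|UNIV :: 'o set| \<le>o |UNIV :: (nat + 'o + 'm + 'a + 'l) set|"
    by (rule inj_UNIV_ordLeq[of "\<lambda>x. Inr (Inl x)"]) (simp add: inj_def)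
  have m: "|UNIV :: 'm set| \<le>o |UNIV :: (nat + 'o + 'm + 'a + 'l) set|"
    by (rule inj_UNIV_ordLeq[of "\<lambda>x. Inr (Inr (Inl x))"]) (simp add: inj_def)
  have a: "|UNIV :: 'a set| \<le>o |UNIV :: (nat + 'o + 'm + 'a + 'l) set|"
    by (rule inj_UNIV_ordLeq[of "\<lambda>x. Inr (Inr (Inr (Inl x)))"]) (simp add: inj_def)
  have l: "|UNIV :: 'l set| \<le>o |UNIV :: (nat + 'o + 'm + 'a + 'l) set|"
    by (rule inj_UNIV_ordLeq[of "\<lambda>x. Inr (Inr (Inr (Inr x)))"]) (simp add: inj_def)
  obtain z where z: "z \<in> Obj \<C>"
    using assms(1) by (auto simp: additive_category_def zero_object_def)
  obtain cls :: "'o \<times> 'u \<Rightarrow> 'l" where cls: "\<And>a x y. a \<in> Obj \<C> \<Longrightarrow> x \<in> carrier (grp M a)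
      \<Longrightarrow> y \<in> carrier (grp M a) \<Longrightarrow> cls (a, x) = cls (a, y) \<Longrightarrow> diff M a x y \<in> L a"
    using quotient_colouring[OF cat assms(2) M L assms(4) small] by blast
  have x0: "(z, \<one>\<^bsub>grp M z\<^esub>) \<in> Sigma (Obj \<C>) (carr M)"
    using z submodule_one[OF submodule_carrier[OF M] z] by simp
  obtain B where B: "submodule \<C> B M"
    and Bs: "|Sigma (Obj \<C>) B| \<le>o |UNIV :: (nat + 'o + 'm + 'a + 'l) set set set|"
    and copy: "\<And>Q. submodule \<C> Q M \<Longrightarrow> |Sigma (Obj \<C>) Q| \<le>o |UNIV :: (nat + 'o + 'm + 'a + 'l) set set| \<Longrightarrow>
      \<exists>\<phi>. copies_into \<C> M cls Q B \<phi>"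
    using small_reflecting_submodule[OF M infinite_set[OF inf] ordLeq_set[OF o] ordLeq_set[OF m]
      ordLeq_set[OF l] x0, where cls = cls] by blast
  have "|Sigma (Obj \<C>) B| <o |UNIV :: ('o, 'm, 'a, 'l) bound set|"
    using Bs card_of_Pow[of "UNIV :: (nat + 'o + 'm + 'a + 'l) set set set", unfolded Pow_UNIV]
    by (rule ordLeq_ordLess_trans)
  then have "|Sigma (Obj \<C>) B| <o |Sigma S (carr M)|"
    using big unfolding module_card_def by (rule ordLess_ordLeq_trans)
  \<comment> \<open>B has at most 2^2^mu elements, so it cannot exhaust M even over the skeleton.\<close>
  then have "\<not> Sigma S (carr M) \<subseteq> Sigma (Obj \<C>) B"
    using card_of_mono1 not_ordLess_ordLeq by blast
  then obtain c x where c: "c \<in> Obj \<C>" and x: "x \<in> carrier (grp M c)" and xB: "x \<notin> B c"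
    using SC by blast
  obtain Q where Q: "submodule \<C> Q M"
    and Qs: "|Sigma (Obj \<C>) Q| \<le>o |UNIV :: (nat + 'o + 'm + 'a + 'l) set set|"
    and xQ: "x \<in> Q c" and pure: "pure_modulo \<C> \<A> B Q M"
    by (rule small_pure_modulo[OF M inf o m a c x])
  obtain \<phi> where \<phi>: "copies_into \<C> M cls Q B \<phi>" using copy[OF Q Qs] by (rule exE)
  have \<phi>B: "\<phi> a x \<in> B a" and \<phi>cls: "cls (a, \<phi> a x) = cls (a, x)" if "a \<in> Obj \<C>" "x \<in> Q a" for a x
    using \<phi> that by (simp_all add: copies_into_def)
  let ?D = "\<lambda>a. (\<lambda>x. diff M a x (\<phi> a x)) ` Q a"
  have "?D a \<subseteq> L a" if a: "a \<in> Obj \<C>" for a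
    using cls[OF a submodule_mem[OF Q a] submodule_mem[OF B a \<phi>B[OF a]]] \<phi>cls[OF a] by auto
  moreover have "pure_submodule \<C> \<A> ?D M"
    by (rule pure_difference_submodule[OF C M assms(3) B Q pure \<phi>])
  moreover have "nonzero_sub \<C> ?D M"
  proof -
    have "diff M c x (\<phi> c x) \<noteq> \<one>\<^bsub>grp M c\<^esub>"
      using diff_eq_one[OF M c x submodule_mem[OF B c \<phi>B[OF c xQ]]] \<phi>B[OF c xQ] xB by auto
    then show ?thesis using c xQ by (auto simp: nonzero_sub_def)
  qed
  ultimately show "\<exists>P. (\<forall>a\<in>Obj \<C>. P a \<subseteq> L a) \<and> pure_submodule \<C> \<A> P M \<and> nonzero_sub \<C> P M"
    by (intro exI[of _ ?D] conjI ballI)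
qed

end
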